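(* Let $n,l\in\mathbb N_0$, $n\ge l$, $\nu,\mu\in\mathbb C$, and let $z\in\mathbb C\setminus(-\infty,1]$. Then $$\int_{-1}^1\frac{{\sf P}_{n+\mu}^{-\mu}(x)}{(z-x)^\nu}\,(1-x^2)^{\frac{\mu}{2}}\,\mathrm dx=\frac{2\,(\nu)_n\,\boldsymbol{Q}_{n+\mu}^{\nu-\mu-1}(z)}{(z^2-1)^{\frac{\nu-\mu-1}{2}}}.$$
   Context: $\mathbb N_0=\{0,1,2,\ldots\}$; $(a)_0=1$, $(a)_n=a(a+1)\cdots(a+n-1)$ is the Pochhammer symbol, and ${}_2F_1(a,b;c;z)=\sum_{j\ge0}\frac{(a)_j(b)_j}{(c)_j}\frac{z^j}{j!}$, elsewhere by analytic continuation. (The integer $l$ does not occur in the formula.) The Ferrers function of the first kind is, for $x\in(-1,1)$, $${\sf P}_\nu^{-\mu}(x)=\frac{1}{\Gamma(\mu+1)}\left(\frac{1-x}{1+x}\right)^{\frac{\mu}{2}}{}_2F_1\left(-\nu,\nu+1;\mu+1;\frac{1-x}{2}\right).$$ The (Olver-normalized) associated Legendre function of the second kind is $$\boldsymbol{Q}_\nu^\mu(z)=\frac{\sqrt\pi\,(z^2-1)^{\mu/2}}{2^{\nu+1}\,\Gamma(\nu+\frac32)\,z^{\nu+\mu+1}}\,{}_2F_1\left(\frac{\nu+\mu+1}{2},\frac{\nu+\mu+2}{2};\nu+\frac32;\frac{1}{z^2}\right),\qquad |z|>1,$$ extended by analytic continuation of the Gauss hypergeometric function to $z\in\mathbb C\setminus(-\infty,1]$.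 Branches: $(z^2-1)^{a}=(z-1)^a(z+1)^a$ with principal powers on $\mathbb C\setminus(-\infty,1]$; $(z-x)^\nu$ and $(1-x^2)^{\mu/2}$ are principal.
   Formalization: The condition Re μ > −1 is added: for other μ the integral diverges at x = 1 or, for negative integer μ, the Ferrers function as given is undefined; integrability of the integrand is also proved. *)

theory Defs
  imports "HOL-Complex_Analysis.Complex_Analysis"
begin

definition gauss_series :: "complex \<Rightarrow> complex \<Rightarrow> complex \<Rightarrow> complex \<Rightarrow> complex" where
  "gauss_series a b c z =
     (\<Sum>j. pochhammer a j * pochhammer b j / pochhammer c j * (z ^ j / fact j))"

lemma gauss_series_eq_eval_fps:
  "gauss_series a b c z = eval_fps (fps_hypergeo [a, b] [c] 1) z"
  by (simp add: gauss_series_def eval_fps_def field_simps)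

definition gauss_slit :: "complex set" where
  "gauss_slit = complex_of_real ` {1..}"

text \<open>
  The principal branch of the Gauss hypergeometric function: the power series in the open unit
  disc, elsewhere the value of its holomorphic extension to the complex plane cut along
  \<open>[1, \<infinity>)\<close>. By the lemma \<open>hyp2f1_eq_continuation\<close> below, the choice operator does not
  introduce any ambiguity off the cut; values on the cut carry no meaning.
\<close>
definition hyp2f1 :: "complex \<Rightarrow> complex \<Rightarrow> complex \<Rightarrow> complex \<Rightarrow> complex" where
  "hyp2f1 a b c z =
     (if norm z < 1 then gauss_series a b c z
      else (SOME f. f holomorphic_on (- gauss_slit) \<and>
                    (\<forall>w. norm w < 1 \<longrightarrow> f w = gauss_series a b c w)) z)"

lemma hyp2f1_eq_continuation:
  assumes f: "f holomorphic_on (- gauss_slit)"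
    and fs: "\<And>w. norm w < 1 \<Longrightarrow> f w = gauss_series a b c w"
    and z: "z \<notin> gauss_slit"
  shows "hyp2f1 a b c z = f z"
proof (cases "norm z < 1")
  case True
  then show ?thesis using fs by (simp add: hyp2f1_def)
next
  case False
  define P where "P = (\<lambda>f. f holomorphic_on (- gauss_slit) \<and>
                    (\<forall>w. norm w < 1 \<longrightarrow> f w = gauss_series a b c w))"
  have "P f" using f fs by (simp add: P_def)
  then have g: "P (Eps P)" by (rule someI[of P f])
  have slit: "gauss_slit = {w. w \<in> \<real> \<and> 1 \<le> Re w}"
    by (auto simp: gauss_slit_def Reals_def image_iff)
  have "gauss_slit = \<real> \<inter> {w. 1 \<le> Re w}" by (auto simp: slit)
  then have "closed gauss_slit"
    using closed_Int[OF closed_complex_Reals closed_halfspace_Re_ge[of 1]] by simp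
  then have op: "open (- gauss_slit)" by (simp add: open_Compl)
  have "starlike (- gauss_slit)"
    unfolding starlike_def
  proof (intro bexI ballI subsetI)
    show "0 \<in> - gauss_slit" by (auto simp: slit)
  next
    fix w v assume w: "w \<in> - gauss_slit" and v: "v \<in> closed_segment 0 w"
    obtain u where u: "0 \<le> u" "u \<le> 1" "v = of_real u * w"
      using v by (auto simp: in_segment scaleR_conv_of_real)
    show "v \<in> - gauss_slit"
    proof
      assume "v \<in> gauss_slit"
      then obtain t where t: "1 \<le> t" "of_real u * w = of_real t"
        using u by (auto simp: gauss_slit_def)
      then have "u \<noteq> 0" by auto
      then have "w = of_real (t / u)" using t by (simp add: field_simps)
      moreover have "t / u \<in> {1..}" using t u \<open>u \<noteq> 0\<close> by (simp add: field_simps)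
      ultimately show False using w unfolding gauss_slit_def by blast
    qed
  qed
  then have con: "connected (- gauss_slit)" by (rule starlike_imp_connected)
  have sub: "ball 0 1 \<subseteq> - gauss_slit"
  proof
    fix w :: complex assume "w \<in> ball 0 1"
    then show "w \<in> - gauss_slit"
      using abs_Re_le_cmod[of w] by (auto simp: slit)
  qed
  have "Eps P z = f z"
  proof (rule analytic_continuation_open[where f = "Eps P" and g = f and s = "ball 0 1" and s' = "- gauss_slit"])
    show "Eps P holomorphic_on - gauss_slit" using g by (simp add: P_def)
    show "Eps P w = f w" if "w \<in> ball 0 1" for w
      using g that fs by (simp add: P_def)
  qed (use op con sub f z in auto)
  then show ?thesis using False by (simp add: hyp2f1_def P_def)
qed

text \<open>
  \<open>ferrers_P_neg \<nu> \<mu> x\<close> is the Ferrers function of the first kind of degree \<open>\<nu>\<close> and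
  order \<open>-\<mu>\<close> (note the sign), for \<open>-1 < x < 1\<close> and \<open>\<mu>\<close> not a negative integer.
\<close>
definition ferrers_P_neg :: "complex \<Rightarrow> complex \<Rightarrow> real \<Rightarrow> complex" where
  "ferrers_P_neg \<nu> \<mu> x =
     1 / Gamma (\<mu> + 1) * of_real ((1 - x) / (1 + x)) powr (\<mu> / 2) *
     hyp2f1 (- \<nu>) (\<nu> + 1) (\<mu> + 1) (of_real ((1 - x) / 2))"

text \<open>
  The branch of \<open>(z\<^sup>2 - 1)\<^sup>a\<close> that is holomorphic off \<open>(-\<infinity>, 1]\<close>; it is in general not
  \<open>(z\<^sup>2 - 1) powr a\<close> when \<open>Re z < 0\<close>.
\<close>
definition sqm1_powr :: "complex \<Rightarrow> complex \<Rightarrow> complex" where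
  "sqm1_powr z a = (z - 1) powr a * (z + 1) powr a"

text \<open>
  Olver's associated Legendre function of the second kind, degree \<open>\<nu>\<close> and order \<open>\<mu>\<close>, for
  \<open>z\<close> off \<open>(-\<infinity>, 1]\<close>. For such \<open>z\<close> the point \<open>1 / z\<^sup>2\<close> is never on the cut \<open>[1, \<infinity>)\<close>, so
  the principal branches below give the continuation from \<open>norm z > 1\<close> to all of this domain.
\<close>
definition olver_Q :: "complex \<Rightarrow> complex \<Rightarrow> complex \<Rightarrow> complex" where
  "olver_Q \<nu> \<mu> z =
     of_real (sqrt pi) * sqm1_powr z (\<mu> / 2) /
       (2 powr (\<nu> + 1) * Gamma (\<nu> + 3 / 2) * z powr (\<nu> + \<mu> + 1)) *
     hyp2f1 ((\<nu> + \<mu> + 1) / 2) ((\<nu> + \<mu> + 2) / 2) (\<nu> + 3 / 2) (1 / z\<^sup>2)"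

end

theory Submission
  imports Defs
begin

text \<open>
  Put \<open>a = n + \<mu>\<close> and \<open>t = (1 - x) / 2\<close>. Differentiating the binomial expansion of
  \<open>t\<^sup>a (1 - t)\<^sup>a\<close> term by term \<open>n\<close> times gives a multiple of \<open>t\<^sup>\<mu>\<close> times the hypergeometric
  series of the Ferrers function. Hence \<open>P(x) (1 - x\<^sup>2)\<^bsup>\<mu>/2\<^esup>\<close> is a multiple of the \<open>n\<close>-th derivative
  of \<open>(1 - x\<^sup>2)\<^sup>a\<close>, that is, of \<open>(1 - x\<^sup>2)\<^sup>\<mu>\<close> times a polynomial in \<open>x\<close> (\<open>ferrers_weight_eq\<close>).

  Integrating by parts \<open>n\<close> times against \<open>(z - x)\<^bsup>-\<nu>\<^esup>\<close>, with vanishing boundary terms, moves the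
  derivatives to that factor (\<open>rodrigues_integral_by_parts\<close>). This produces \<open>(\<nu>)\<^sub>n\<close> and leaves the
  integral of \<open>(1 - x\<^sup>2)\<^sup>a (z - x)\<^bsup>-\<nu>-n\<^esup>\<close> over \<open>(-1, 1)\<close>.

  For \<open>\<bar>z\<bar> > 1\<close> that integral is found by expanding in powers of \<open>x / z\<close>: the odd moments of
  \<open>(1 - x\<^sup>2)\<^sup>a\<close> vanish and the even ones follow from a two-term recurrence, so a hypergeometric
  series in \<open>1 / z\<^sup>2\<close> results. For the other \<open>z\<close>, the integral of \<open>(1 - x\<^sup>2)\<^sup>a (1 - x w)\<^bsup>-\<nu>-n\<^esup>\<close> is a
  holomorphic even function of \<open>w\<close> off \<open>(-\<infinity>, -1] \<union> [1, \<infinity>)\<close>, hence a holomorphic function of \<open>w\<^sup>2\<close> off \<open>[1, \<infinity>)\<close>. It is thus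
  the continuation that defines the principal branch (\<open>gegenbauer_transform_eq_hyp2f1\<close>), and
  \<open>w = 1 / z\<close> gives the value (\<open>gegenbauer_weight_cauchy_integral\<close>).
\<close>

section \<open>The Rodrigues formula in terms of power series\<close>

text \<open>
  The derivative \<open>d\<^sup>j/dt\<^sup>j [t\<^sup>a (1 - t)\<^sup>a]\<close> equals \<open>t\<^sup>b (1 - t)\<^sup>b q(t)\<close> with \<open>b = a - j\<close> and
  \<open>q = rodrigues_poly a j\<close>; the recursion is the product rule.
\<close>
primrec rodrigues_poly :: "complex \<Rightarrow> nat \<Rightarrow> complex poly" where
  "rodrigues_poly a 0 = 1"
| "rodrigues_poly a (Suc j) =
     smult (a - of_nat j) ([:1, -2:] * rodrigues_poly a j) +
     [:0, 1, -1:] * pderiv (rodrigues_poly a j)"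

text \<open>
  The same derivative, computed term by term from the binomial series of \<open>(1 - t)\<^sup>a\<close>, is
  \<open>t\<^sup>b\<close> times the power series \<open>rodrigues_fps a j\<close>, again with \<open>b = a - j\<close>.
\<close>
primrec rodrigues_fps :: "complex \<Rightarrow> nat \<Rightarrow> complex fps" where
  "rodrigues_fps a 0 = Abs_fps (\<lambda>k. (- 1) ^ k * (a gchoose k))"
| "rodrigues_fps a (Suc j) =
     fps_const (a - of_nat j) * rodrigues_fps a j + fps_X * fps_deriv (rodrigues_fps a j)"

lemma one_minus_notin_nonpos_Reals:
  assumes "norm (t :: complex) < 1"
  shows "1 - t \<notin> \<real>\<^sub>\<le>\<^sub>0"
proof
  assume "1 - t \<in> \<real>\<^sub>\<le>\<^sub>0"
  then have "Re (1 - t) \<le> 0" by (auto simp: complex_nonpos_Reals_iff)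
  with complex_Re_le_cmod[of t] assms show False by simp
qed

lemma binomial_series_one_minus:
  fixes t a :: complex
  assumes "norm t < 1"
  shows "(\<lambda>k. (- 1) ^ k * (a gchoose k) * t ^ k) sums ((1 - t) powr a)"
  using gen_binomial_complex[of "- t" a] assms
  by (simp add: power_minus[of t] mult_ac)

lemma fps_conv_radius_rodrigues_fps: "fps_conv_radius (rodrigues_fps a j) \<ge> 1"
proof (induction j)
  case 0
  have "fps_conv_radius (rodrigues_fps a 0) \<ge> ereal 1"
    unfolding fps_conv_radius_def
  proof (rule conv_radius_geI_ex)
    fix r :: real assume "0 < r" "ereal r < ereal 1"
    then show "\<exists>z. norm z = r \<and> summable (\<lambda>k. fps_nth (rodrigues_fps a 0) k * z ^ k)"
      using sums_summable[OF binomial_series_one_minus[of "of_real r" a]]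
      by (intro exI[of _ "of_real r"]) auto
  qed
  then show ?case by (simp add: one_ereal_def)
next
  case (Suc j)
  have "1 \<le> min (fps_conv_radius (fps_const (a - of_nat j) * rodrigues_fps a j))
                 (fps_conv_radius (fps_X * fps_deriv (rodrigues_fps a j)))"
    using Suc fps_conv_radius_mult[of "fps_const (a - of_nat j)" "rodrigues_fps a j"]
      fps_conv_radius_mult[of "fps_X :: complex fps" "fps_deriv (rodrigues_fps a j)"]
      fps_conv_radius_deriv[of "rodrigues_fps a j"]
    by (auto intro: order_trans)
  also have "\<dots> \<le> fps_conv_radius (rodrigues_fps a (Suc j))"
    unfolding rodrigues_fps.simps by (rule fps_conv_radius_add)
  finally show ?case .
qed

text \<open>
  The two descriptions of the \<open>j\<close>-th derivative agree. The common factor \<open>t powr (a - j)\<close> is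
  cancelled, so that the identity holds in the whole unit disc and not only for \<open>t > 0\<close>.
\<close>
lemma eval_rodrigues_fps:
  fixes t a :: complex
  assumes "norm t < 1"
  shows "eval_fps (rodrigues_fps a j) t =
           (1 - t) powr (a - of_nat j) * poly (rodrigues_poly a j) t"
  using assms
proof (induction j arbitrary: t)
  case 0
  then show ?case
    using binomial_series_one_minus[of t a] by (simp add: eval_fps_def sums_iff)
next
  case (Suc j)
  define b where "b = a - of_nat j"
  let ?f = "rodrigues_fps a j" and ?q = "rodrigues_poly a j"
  have rad: "ereal (norm t) < fps_conv_radius ?f"
    "ereal (norm t) < fps_conv_radius (fps_deriv ?f)"
    using Suc.prems fps_conv_radius_rodrigues_fps[of a j] fps_conv_radius_deriv[of ?f]
    by (auto simp: one_ereal_def elim!: order_less_le_trans[rotated] intro: less_le_trans)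
  have "(eval_fps ?f has_field_derivative eval_fps (fps_deriv ?f) t) (at t)"
    by (rule has_field_derivative_eval_fps) (fact rad)
  moreover have "(eval_fps ?f has_field_derivative
      (1 - t) powr b * poly (pderiv ?q) t - b * (1 - t) powr (b - 1) * poly ?q t) (at t)"
  proof (rule has_field_derivative_transform_within_open[where S = "ball 0 1"])
    show "((\<lambda>t. (1 - t) powr b * poly ?q t) has_field_derivative
      (1 - t) powr b * poly (pderiv ?q) t - b * (1 - t) powr (b - 1) * poly ?q t) (at t)"
      using one_minus_notin_nonpos_Reals[OF Suc.prems]
      by (auto intro!: derivative_eq_intros poly_DERIV simp: algebra_simps)
  qed (use Suc in \<open>auto simp: b_def\<close>)
  ultimately have deriv: "eval_fps (fps_deriv ?f) t =
      (1 - t) powr b * poly (pderiv ?q) t - b * (1 - t) powr (b - 1) * poly ?q t"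
    by (rule DERIV_unique)
  have "1 - t \<noteq> 0" using one_minus_notin_nonpos_Reals[OF Suc.prems] by auto
  then have shift: "(1 - t) powr b = (1 - t) * (1 - t) powr (b - 1)"
    by (simp add: powr_diff)
  have "eval_fps (rodrigues_fps a (Suc j)) t =
      b * eval_fps ?f t + t * eval_fps (fps_deriv ?f) t"
    using rad fps_conv_radius_mult[of "fps_X :: complex fps" "fps_deriv ?f"]
      fps_conv_radius_mult[of "fps_const b" ?f]
    by (subst rodrigues_fps.simps, subst eval_fps_add)
       (auto simp: b_def eval_fps_mult intro: less_le_trans)
  also have "\<dots> = b * ((1 - t) powr b * poly ?q t) +
      t * ((1 - t) powr b * poly (pderiv ?q) t - b * (1 - t) powr (b - 1) * poly ?q t)"
    using Suc by (simp add: deriv b_def)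
  also have "\<dots> = (1 - t) powr (b - 1) * poly (rodrigues_poly a (Suc j)) t"
    unfolding shift by (simp add: b_def algebra_simps)
  also have "b - 1 = a - of_nat (Suc j)" by (simp add: b_def)
  finally show ?case .
qed

lemma rodrigues_fps_nth:
  "fps_nth (rodrigues_fps a j) k =
     (- 1) ^ k * (a gchoose k) * (\<Prod>i<j. a + of_nat k - of_nat i)"
proof (induction j)
  case (Suc j)
  then show ?case by (cases k) (simp_all add: algebra_simps)
qed simp

text \<open>
  After \<open>n\<close> steps with \<open>a = n + \<mu>\<close> the power series is, up to a constant factor, the
  hypergeometric series that occurs in the Ferrers function of degree \<open>n + \<mu>\<close> and order \<open>-\<mu>\<close>.
\<close>
lemma eval_rodrigues_fps_eq_gauss_series:
  fixes \<mu> t :: complex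
  assumes "Re \<mu> > -1" and "norm t < 1"
  shows "eval_fps (rodrigues_fps (of_nat n + \<mu>) n) t =
     pochhammer (\<mu> + 1) n * gauss_series (- (of_nat n + \<mu>)) (of_nat n + \<mu> + 1) (\<mu> + 1) t"
proof -
  have nz: "pochhammer (\<mu> + 1) k \<noteq> 0" for k
  proof
    assume "pochhammer (\<mu> + 1) k = 0"
    then obtain i :: nat where "\<mu> + 1 = - of_nat i" by (auto simp: pochhammer_eq_0_iff)
    then have "Re (\<mu> + 1) = - real i" by simp
    with assms show False by simp
  qed
  define l where "l = of_nat n + \<mu>"
  have coeff: "fps_nth (rodrigues_fps l n) k =
     pochhammer (\<mu> + 1) n * (pochhammer (- l) k * pochhammer (l + 1) k /
       pochhammer (\<mu> + 1) k / fact k)" for k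
  proof -
    have "(\<Prod>i<n. l + of_nat k - of_nat i) = (\<Prod>i<n. \<mu> + 1 + of_nat k + of_nat i)"
      by (rule prod.reindex_bij_witness[where i = "\<lambda>i. n - 1 - i" and j = "\<lambda>i. n - 1 - i"])
         (auto simp: l_def of_nat_diff algebra_simps)
    also have "\<dots> = pochhammer (\<mu> + 1 + of_nat k) n"
      by (simp add: pochhammer_prod atLeast0LessThan)
    also have "\<dots> = pochhammer (\<mu> + 1) n * pochhammer (l + 1) k / pochhammer (\<mu> + 1) k"
      using pochhammer_product'[of "\<mu> + 1" k n] pochhammer_product'[of "\<mu> + 1" n k] nz[of k]
      by (simp add: field_simps l_def add_ac)
    finally show ?thesis
      by (simp add: rodrigues_fps_nth gbinomial_pochhammer mult_ac flip: power_mult_distrib)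
  qed
  have "summable (\<lambda>k. fps_nth (rodrigues_fps l n) k * t ^ k)"
    using assms(2) fps_conv_radius_rodrigues_fps[of l n]
    by (intro summable_fps) (auto simp: one_ereal_def intro: less_le_trans[of _ "ereal 1"])
  then have "summable (\<lambda>k. pochhammer (\<mu> + 1) n *
        (pochhammer (- l) k * pochhammer (l + 1) k / pochhammer (\<mu> + 1) k * (t ^ k / fact k)))"
    by (simp add: coeff mult_ac)
  then have "summable (\<lambda>k. pochhammer (- l) k * pochhammer (l + 1) k /
                pochhammer (\<mu> + 1) k * (t ^ k / fact k))"
    using nz[of n] by (simp only: summable_cmult_iff) simp
  then show ?thesis
    by (simp add: eval_fps_def gauss_series_def coeff mult_ac flip: suminf_mult l_def)
qed

section \<open>Holomorphic dependence of integrals on a parameter\<close>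

text \<open>
  The Cauchy estimate turns a local dominating function for the integrand into one for its
  difference quotients, and dominated convergence then differentiates under the integral sign.
\<close>
lemma holomorphic_on_lebesgue_integral:
  fixes f :: "complex \<Rightarrow> 'a \<Rightarrow> complex"
  assumes "open S"
    and meas: "\<And>w. w \<in> S \<Longrightarrow> f w \<in> borel_measurable M"
    and holo: "\<And>x. x \<in> space M \<Longrightarrow> (\<lambda>w. f w x) holomorphic_on S"
    and bound: "\<And>w. w \<in> S \<Longrightarrow> \<exists>e>0. \<exists>G. cball w e \<subseteq> S \<and> integrable M G \<and>
                  (\<forall>u\<in>cball w e. \<forall>x\<in>space M. norm (f u x) \<le> (G x :: real))"
  shows "(\<lambda>w. \<integral>x. f w x \<partial>M) holomorphic_on S"
proof -
  have "(\<lambda>w. \<integral>x. f w x \<partial>M) field_differentiable (at w)" if w: "w \<in> S" for w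
  proof -
    obtain e G where e: "e > 0" "cball w e \<subseteq> S" and G: "integrable M G"
      and fG: "\<And>u x. u \<in> cball w e \<Longrightarrow> x \<in> space M \<Longrightarrow> norm (f u x) \<le> G x"
      using bound[OF w] by metis
    define D where "D = (\<lambda>x. deriv (\<lambda>w. f w x) w)"
    have int: "integrable M (f u)" if "u \<in> cball w e" for u
    proof (rule Bochner_Integration.integrable_bound[OF G])
      show "f u \<in> borel_measurable M" using meas[of u] that e by auto
      show "AE x in M. norm (f u x) \<le> norm (G x)"
        using fG[OF that] by (intro AE_I2) (metis abs_ge_self order_trans real_norm_def)
    qed
    have dderiv: "((\<lambda>w. f w x) has_field_derivative deriv (\<lambda>w. f w x) u) (at u)"
      if "x \<in> space M" "u \<in> S" for x u
      using holo[OF that(1)] \<open>open S\<close> that(2) by (rule holomorphic_derivI)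
    \<comment> \<open>derivative bound on the half-size disc, from discs of radius \<open>e/2\<close> inside \<open>cball w e\<close>\<close>
    have dbound: "norm (deriv (\<lambda>w. f w x) u) \<le> G x * (2 / e)"
      if x: "x \<in> space M" and u: "u \<in> cball w (e/2)" for x u
    proof -
      have sub: "cball u (e/2) \<subseteq> cball w e"
        using u by (simp add: cball_subset_cball_iff dist_commute)
      have hol: "(\<lambda>w. f w x) holomorphic_on cball u (e/2)"
        by (rule holomorphic_on_subset[OF holo[OF x]]) (use sub e in auto)
      have "norm ((deriv ^^ 1) (\<lambda>w. f w x) u) \<le> fact 1 * G x / (e/2) ^ 1"
      proof (rule Cauchy_inequality)
        show "(\<lambda>w. f w x) holomorphic_on ball u (e/2)"
          by (rule holomorphic_on_subset[OF hol]) auto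
        show "continuous_on (cball u (e/2)) (\<lambda>w. f w x)"
          by (rule holomorphic_on_imp_continuous_on[OF hol])
        show "norm (f v x) \<le> G x" if "norm (u - v) = e/2" for v
          using sub that by (intro fG x) (auto simp: dist_norm)
      qed (use e in simp)
      then show ?thesis by simp
    qed
    have quot: "norm ((f u x - f w x) / (u - w)) \<le> G x * (2 / e)"
      if x: "x \<in> space M" and u: "u \<in> cball w (e/2)" "u \<noteq> w" for x u
    proof -
      have "norm (f u x - f w x) \<le> G x * (2 / e) * norm (u - w)"
      proof (rule field_differentiable_bound[OF convex_cball])
        show "((\<lambda>w. f w x) has_field_derivative deriv (\<lambda>w. f w x) v) (at v within cball w (e/2))"
          if "v \<in> cball w (e/2)" for v
          using that e by (intro has_field_derivative_at_within[OF dderiv[OF x]]) auto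
      qed (use dbound[OF x] u e in auto)
      then show ?thesis using u e by (simp add: norm_divide divide_simps)
    qed
    have "((\<lambda>u. ((\<integral>x. f u x \<partial>M) - (\<integral>x. f w x \<partial>M)) / (u - w)) \<longlongrightarrow> (\<integral>x. D x \<partial>M)) (at w)"
      unfolding tendsto_at_iff_sequentially comp_def
    proof (intro allI impI)
      fix X assume X: "\<forall>i. X i \<in> UNIV - {w}" "X \<longlonglongrightarrow> w"
      have "eventually (\<lambda>i. X i \<in> ball w (e/2)) sequentially"
        using X(2) e by (intro topological_tendstoD) auto
      then obtain N where N: "\<And>i. i \<ge> N \<Longrightarrow> X i \<in> ball w (e/2)"
        by (auto simp: eventually_sequentially)
      define Y where "Y = (\<lambda>i. X (i + N))"
      have Yb: "Y i \<in> ball w (e/2)" and Yw: "Y i \<noteq> w" for i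
        using N[of "i + N"] X(1) by (auto simp: Y_def)
      have Y: "Y \<longlonglongrightarrow> w" unfolding Y_def by (rule LIMSEQ_ignore_initial_segment[OF X(2)])
      have YS: "Y i \<in> S" "Y i \<in> cball w e" for i using Yb[of i] e by auto
      have meas': "(\<lambda>x. (f (Y i) x - f w x) / (Y i - w)) \<in> borel_measurable M" for i
        using meas[OF YS(1)] meas[OF w] by measurable
      have lim: "(\<lambda>i. (f (Y i) x - f w x) / (Y i - w)) \<longlonglongrightarrow> D x" if x: "x \<in> space M" for x
        using dderiv[OF x w] Y Yw
        unfolding D_def has_field_derivative_iff tendsto_at_iff_sequentially comp_def by auto
      have "(\<lambda>i. \<integral>x. (f (Y i) x - f w x) / (Y i - w) \<partial>M) \<longlonglongrightarrow> (\<integral>x. D x \<partial>M)"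
      proof (rule integral_dominated_convergence)
        show "D \<in> borel_measurable M"
          using meas' lim by (rule borel_measurable_LIMSEQ_metric)
        show "integrable M (\<lambda>x. G x * (2 / e))" using G by simp
        show "AE x in M. (\<lambda>i. (f (Y i) x - f w x) / (Y i - w)) \<longlonglongrightarrow> D x"
          using lim by (intro AE_I2)
        show "AE x in M. norm ((f (Y i) x - f w x) / (Y i - w)) \<le> G x * (2 / e)" for i
          using Yb[of i] Yw[of i] by (intro AE_I2 quot) auto
      qed (rule meas')
      also have "(\<lambda>i. \<integral>x. (f (Y i) x - f w x) / (Y i - w) \<partial>M) =
          (\<lambda>i. ((\<integral>x. f (Y i) x \<partial>M) - (\<integral>x. f w x \<partial>M)) / (Y i - w))"
        using int YS(2) e by (simp add: int)
      finally show "(\<lambda>i. ((\<integral>x. f (X i) x \<partial>M) - (\<integral>x. f w x \<partial>M)) / (X i - w))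
                      \<longlonglongrightarrow> (\<integral>x. D x \<partial>M)"
        unfolding Y_def by (rule LIMSEQ_offset)
    qed
    then show ?thesis
      unfolding field_differentiable_def has_field_derivative_iff by blast
  qed
  then show ?thesis
    using \<open>open S\<close> by (auto simp: holomorphic_on_open field_differentiable_def)
qed

section \<open>The weight \<open>(1 - x\<^sup>2)\<^sup>s\<close> and its moments\<close>

text \<open>
  The substitution \<open>x = 2 t - 1\<close> leads to \<open>Beta (s + 1) (s + 1)\<close>, and Legendre's duplication formula
  brings the value into this form.
\<close>
lemma beta_interval_integral_real:
  fixes s :: real
  assumes "s > -1"
  shows "set_integrable lborel {-1<..<1} (\<lambda>x. (1 - x\<^sup>2) powr s)"
    and "(LBINT x:{-1<..<1}. (1 - x\<^sup>2) powr s) = sqrt pi * Gamma (s + 1) / Gamma (s + 3/2)"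
proof -
  let ?f = "\<lambda>x::real. indicator {-1<..<1} x *\<^sub>R (1 - x\<^sup>2) powr s"
  let ?g = "\<lambda>t::real. indicator {0..1} t *\<^sub>R (t powr s * (1 - t) powr s)"
  have "set_integrable lborel {0..1} (\<lambda>t. t powr s * (1 - t) powr s)"
    using integrable_Beta[of "s + 1" "s + 1"] assms by simp
  moreover have "integral {0..1} (\<lambda>t. t powr s * (1 - t) powr s) = Beta (s + 1) (s + 1)"
    using has_integral_Beta_real[of "s + 1" "s + 1"] assms by (simp add: integral_unique)
  ultimately have "has_bochner_integral lborel ?g (Beta (s + 1) (s + 1))"
    unfolding has_bochner_integral_iff
    using set_borel_integral_eq_integral(2)[of "{0..1}" "\<lambda>t. t powr s * (1 - t) powr s"]
    by (simp add: set_integrable_def set_lebesgue_integral_def)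
  then have "has_bochner_integral lborel (\<lambda>t. 4 powr s * ?g t) (4 powr s * Beta (s + 1) (s + 1))"
    by (rule has_bochner_integral_mult_right)
  also have "(\<lambda>t. 4 powr s * ?g t) = (\<lambda>t. ?f (-1 + 2 * t))"
  proof
    fix t :: real
    show "4 powr s * ?g t = ?f (-1 + 2 * t)"
    proof (cases "0 < t \<and> t < 1")
      case True
      have "1 - (-1 + 2 * t)\<^sup>2 = 4 * (t * (1 - t))"
        by (simp add: power2_eq_square algebra_simps)
      then have "(1 - (-1 + 2 * t)\<^sup>2) powr s = 4 powr s * (t powr s * (1 - t) powr s)"
        using True by (simp add: powr_mult)
      then show ?thesis using True by simp
    qed (auto simp: indicator_def)
  qed
  finally have "has_bochner_integral lborel (\<lambda>t. ?f (-1 + 2 * t))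
      ((2 * (4 powr s * Beta (s + 1) (s + 1))) /\<^sub>R \<bar>2\<bar>)" by simp
  then have *: "has_bochner_integral lborel ?f (2 * (4 powr s * Beta (s + 1) (s + 1)))"
    by (subst lborel_has_bochner_integral_real_affine_iff[where c = 2 and t = "-1"]) simp_all
  show "set_integrable lborel {-1<..<1} (\<lambda>x. (1 - x\<^sup>2) powr s)"
    using * by (simp add: has_bochner_integral_iff set_integrable_def)
  have pos: "Gamma (s + 1) > 0" "Gamma (s + 3/2) > 0" "Gamma (2 * s + 2) > 0"
    using assms by (simp_all add: Gamma_real_pos)
  have "complex_of_real (Gamma (s + 1) * Gamma (s + 3/2)) =
        complex_of_real (exp ((1 - 2 * (s + 1)) * ln 2) * sqrt pi * Gamma (2 * s + 2))"
  proof -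
    have "of_real (s + 1) \<notin> (\<int>\<^sub>\<le>\<^sub>0 :: complex set)" "of_real (s + 1) + 1/2 \<notin> (\<int>\<^sub>\<le>\<^sub>0 :: complex set)"
      using assms by (auto elim!: nonpos_Ints_cases simp: complex_eq_iff)
    from Gamma_legendre_duplication[OF this]
    show ?thesis
      by (simp add: algebra_simps flip: Gamma_complex_of_real exp_of_real)
  qed
  then have "Gamma (s + 1) * Gamma (s + 3/2) =
        exp ((1 - 2 * (s + 1)) * ln 2) * sqrt pi * Gamma (2 * s + 2)"
    by (simp only: of_real_eq_iff)
  also have "exp ((1 - 2 * (s + 1)) * ln 2) = 1 / (2 * 4 powr s)"
  proof -
    have "4 powr s = exp (2 * s * ln 2)"
      using ln_realpow[of "2::real" 2] by (simp add: powr_def)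
    then show ?thesis by (simp add: algebra_simps exp_diff exp_minus field_simps exp_add)
  qed
  finally have "2 * (4 powr s * Beta (s + 1) (s + 1)) = sqrt pi * Gamma (s + 1) / Gamma (s + 3/2)"
    using pos by (simp add: Beta_def field_simps)
  then show "(LBINT x:{-1<..<1}. (1 - x\<^sup>2) powr s) = sqrt pi * Gamma (s + 1) / Gamma (s + 3/2)"
    using * by (simp add: has_bochner_integral_iff set_lebesgue_integral_def)
qed

text \<open>
  The weight \<open>(1 - x\<^sup>2)\<^sup>s\<close> on \<open>(-1, 1)\<close>; its exponent is \<open>\<lambda> - 1/2\<close> in the usual normalization
  of the Gegenbauer polynomials with parameter \<open>\<lambda>\<close>.
\<close>
definition gegenbauer_weight :: "complex \<Rightarrow> real \<Rightarrow> complex" where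
  "gegenbauer_weight s x = of_real (1 - x\<^sup>2) powr s"

lemma one_minus_square_pos: "1 - x\<^sup>2 > 0" if "x \<in> {-1<..<1}" for x :: real
  using that by (auto simp: abs_square_less_1)

lemma norm_gegenbauer_weight:
  assumes "x \<in> {-1<..<1}"
  shows "norm (gegenbauer_weight s x) = (1 - x\<^sup>2) powr Re s"
  using one_minus_square_pos[OF assms]
  unfolding gegenbauer_weight_def by (subst norm_powr_real_powr) auto

lemma continuous_on_gegenbauer_weight [continuous_intros]:
  "continuous_on {-1<..<1} (gegenbauer_weight s)"
proof -
  have "Re (of_real (1 - x\<^sup>2) :: complex) > 0" if "x \<in> {-1<..<1}" for x
    using one_minus_square_pos[OF that] by simp
  then show ?thesis
    unfolding gegenbauer_weight_def
    by (intro continuous_intros) (fastforce simp del: Re_complex_of_real of_real_diff)+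
qed

lemma gegenbauer_weight_Suc:
  assumes "x \<in> {-1<..<1}"
  shows "gegenbauer_weight (s + 1) x = of_real (1 - x\<^sup>2) * gegenbauer_weight s x"
  using one_minus_square_pos[OF assms] by (auto simp: gegenbauer_weight_def powr_add)

lemma set_integrable_gegenbauer_weight:
  assumes s: "Re s > -1" and g: "continuous_on {-1..1} g"
  shows "set_integrable lborel {-1<..<1} (\<lambda>x. gegenbauer_weight s x * g x)"
proof -
  have "bounded (g ` {-1..1})"
    by (intro compact_imp_bounded compact_continuous_image g) simp
  then obtain B where B: "\<And>x. x \<in> {-1..1} \<Longrightarrow> norm (g x) \<le> B"
    unfolding bounded_iff by blast
  show ?thesis
  proof (rule set_integrable_bound)
    show "set_integrable lborel {-1<..<1} (\<lambda>x. B * (1 - x\<^sup>2) powr Re s)"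
      using beta_interval_integral_real(1)[OF s] by simp
    have "continuous_on {-1<..<1} (\<lambda>x. gegenbauer_weight s x * g x)"
      by (intro continuous_intros continuous_on_subset[OF g]) auto
    then show "set_borel_measurable lborel {-1<..<1} (\<lambda>x. gegenbauer_weight s x * g x)"
      unfolding set_borel_measurable_def
      by (simp add: borel_measurable_continuous_on_indicator)
    show "AE x in lborel. x \<in> {-1<..<1} \<longrightarrow>
        norm (gegenbauer_weight s x * g x) \<le> norm (B * (1 - x\<^sup>2) powr Re s)"
    proof (intro AE_I2 impI)
      fix x :: real assume x: "x \<in> {-1<..<1}"
      have "norm (gegenbauer_weight s x * g x) = (1 - x\<^sup>2) powr Re s * norm (g x)"
        by (simp only: norm_mult norm_gegenbauer_weight[OF x])
      also have "\<dots> \<le> (1 - x\<^sup>2) powr Re s * B"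
        using x by (intro mult_left_mono B) auto
      also have "\<dots> \<le> norm (B * (1 - x\<^sup>2) powr Re s)"
        by (simp add: mult.commute)
      finally show "norm (gegenbauer_weight s x * g x) \<le> norm (B * (1 - x\<^sup>2) powr Re s)" .
    qed
  qed
qed

text \<open>
  The integrand is the derivative of \<open>(1 - x\<^sup>2)\<^bsup>s+1\<^esup> G(x)\<close>, which vanishes at both end points.
\<close>
lemma gegenbauer_weight_integral_by_parts:
  assumes s: "Re s > -1"
    and G: "continuous_on {-1..1} G" and G': "continuous_on {-1..1} G'"
    and deriv: "\<And>x. x \<in> {-1<..<1} \<Longrightarrow> (G has_vector_derivative G' x) (at x)"
  shows "(LBINT x:{-1<..<1}. gegenbauer_weight s x *
            (of_real (1 - x\<^sup>2) * G' x - 2 * (s + 1) * of_real x * G x)) = 0"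
proof -
  let ?h = "\<lambda>x. gegenbauer_weight s x *
            (of_real (1 - x\<^sup>2) * G' x - 2 * (s + 1) * of_real x * G x)"
  have int: "set_integrable lborel {-1<..<1} ?h"
    by (intro set_integrable_gegenbauer_weight s continuous_intros G G')
  have "(?h has_integral (gegenbauer_weight (s + 1) 1 * G 1 -
            gegenbauer_weight (s + 1) (-1) * G (-1))) {-1..1}"
  proof (rule fundamental_theorem_of_calculus_interior)
    \<comment> \<open>at the end points \<open>0 powr (s + 1) = 0\<close> is the limit value, since \<open>Re (s + 1) > 0\<close>\<close>
    show "continuous_on {-1..1} (\<lambda>x. gegenbauer_weight (s + 1) x * G x)"
      unfolding gegenbauer_weight_def
      using s by (intro continuous_intros G) (auto simp: abs_square_le_1 abs_le_iff)
    show "((\<lambda>x. gegenbauer_weight (s + 1) x * G x) has_vector_derivative ?h x) (at x)"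
      if x: "x \<in> {-1<..<1}" for x
    proof -
      have "((\<lambda>z. (1 - z\<^sup>2) powr (s + 1)) has_field_derivative
          - 2 * (s + 1) * of_real x * (1 - (of_real x)\<^sup>2) powr s) (at (of_real x :: complex))"
      proof -
        have "1 - (of_real x :: complex)\<^sup>2 = of_real (1 - x\<^sup>2)" by simp
        then have "1 - (of_real x :: complex)\<^sup>2 \<notin> \<real>\<^sub>\<le>\<^sub>0"
          using one_minus_square_pos[OF x] by (simp only: nonpos_Reals_of_real_iff)
        then show ?thesis by (auto intro!: derivative_eq_intros simp: algebra_simps)
      qed
      then have "(gegenbauer_weight (s + 1) has_vector_derivative
          - 2 * (s + 1) * of_real x * gegenbauer_weight s x) (at x)"
        unfolding gegenbauer_weight_def
        using has_vector_derivative_real_field[of "\<lambda>z. (1 - z\<^sup>2) powr (s + 1)"] by simp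
      from has_vector_derivative_mult[OF this deriv[OF x]] show ?thesis
        unfolding gegenbauer_weight_Suc[OF x] by (simp add: algebra_simps)
    qed
  qed simp
  then have "(?h has_integral 0) {-1<..<1}"
    by (simp add: has_integral_Icc_iff_Ioo gegenbauer_weight_def)
  then show ?thesis
    using set_borel_integral_eq_integral(2)[OF int] by (simp add: integral_unique)
qed

text \<open>
  For \<open>m = 0\<close> the term with the truncated exponent \<open>m - 1\<close> has the factor \<open>0\<close>.
\<close>
lemma gegenbauer_weight_moment_rec:
  assumes "Re s > -1"
  shows "(of_nat m + 2 * s + 2) * (LBINT x:{-1<..<1}. gegenbauer_weight s x * of_real x ^ (m + 1)) =
         of_nat m * (LBINT x:{-1<..<1}. gegenbauer_weight s x * of_real x ^ (m - 1))"
proof -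
  have "0 = (LBINT x:{-1<..<1}. gegenbauer_weight s x * (of_real (1 - x\<^sup>2) *
        (of_nat m * of_real x ^ (m - 1)) - 2 * (s + 1) * of_real x * of_real x ^ m))"
    by (rule gegenbauer_weight_integral_by_parts[OF assms, symmetric])
       (auto intro!: continuous_intros derivative_eq_intros has_vector_derivative_real_field)
  also have "\<dots> = (LBINT x:{-1<..<1}.
        of_nat m * (gegenbauer_weight s x * of_real x ^ (m - 1)) -
        (of_nat m + 2 * s + 2) * (gegenbauer_weight s x * of_real x ^ (m + 1)))"
  proof (rule set_lebesgue_integral_cong)
    show "\<forall>x. x \<in> {-1<..<1} \<longrightarrow> gegenbauer_weight s x * (of_real (1 - x\<^sup>2) *
        (of_nat m * of_real x ^ (m - 1)) - 2 * (s + 1) * of_real x * of_real x ^ m) =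
        of_nat m * (gegenbauer_weight s x * of_real x ^ (m - 1)) -
        (of_nat m + 2 * s + 2) * (gegenbauer_weight s x * of_real x ^ (m + 1))"
      by (cases m) (auto simp: power2_eq_square algebra_simps)
  qed simp
  also have "\<dots> = of_nat m * (LBINT x:{-1<..<1}. gegenbauer_weight s x * of_real x ^ (m - 1)) -
      (of_nat m + 2 * s + 2) * (LBINT x:{-1<..<1}. gegenbauer_weight s x * of_real x ^ (m + 1))"
    by (subst set_integral_diff)
       (auto intro!: set_integrable_mult_right set_integrable_gegenbauer_weight assms continuous_intros)
  finally show ?thesis by simp
qed

lemma gegenbauer_weight_moment_odd:
  assumes "Re s > -1"
  shows "(LBINT x:{-1<..<1}. gegenbauer_weight s x * of_real x ^ (2 * k + 1)) = 0"
proof (induction k)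
  case 0
  have "2 * s + 2 \<noteq> 0" using assms by (auto simp: complex_eq_iff)
  then show ?case using gegenbauer_weight_moment_rec[OF assms, of 0] by simp
next
  case (Suc k)
  have "of_nat (2 * k + 2) + 2 * s + 2 \<noteq> 0" using assms by (auto simp: complex_eq_iff)
  then show ?case using gegenbauer_weight_moment_rec[OF assms, of "2 * k + 2"] Suc by simp
qed

lemma gegenbauer_weight_moment_even:
  assumes "Re s > -1"
  shows "(LBINT x:{-1<..<1}. gegenbauer_weight s x * of_real x ^ (2 * k)) =
         (LBINT x:{-1<..<1}. gegenbauer_weight s x) *
         (pochhammer (1/2) k / pochhammer (s + 3/2) k)"
proof (induction k)
  case (Suc k)
  define M where "M = (\<lambda>m. LBINT x:{-1<..<1}. gegenbauer_weight s x * of_real x ^ m)"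
  have nz: "s + 3/2 + of_nat k \<noteq> 0" using assms by (auto simp: complex_eq_iff)
  have "(of_nat (2 * k + 1) + 2 * s + 2) * M (2 * Suc k) = of_nat (2 * k + 1) * M (2 * k)"
    using gegenbauer_weight_moment_rec[OF assms, of "2 * k + 1"] by (simp add: M_def)
  then have "2 * ((s + 3/2 + of_nat k) * M (2 * Suc k)) = 2 * ((1/2 + of_nat k) * M (2 * k))"
    by (simp add: algebra_simps)
  then have "M (2 * Suc k) = (1/2 + of_nat k) / (s + 3/2 + of_nat k) * M (2 * k)"
    using nz by (simp add: nonzero_eq_divide_eq mult.commute)
  also have "M (2 * k) = M 0 * (pochhammer (1/2) k / pochhammer (s + 3/2) k)"
    using Suc.IH by (simp add: M_def)
  finally show ?case by (simp add: pochhammer_Suc M_def mult_ac)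
qed simp

text \<open>
  For real \<open>s\<close> this is the Beta integral. Both sides are holomorphic in the half plane
  \<open>Re s > -1\<close>, so the identity theorem extends it to complex \<open>s\<close>.
\<close>
lemma gegenbauer_weight_integral:
  assumes "Re s > -1"
  shows "(LBINT x:{-1<..<1}. gegenbauer_weight s x) =
         of_real (sqrt pi) * Gamma (s + 1) / Gamma (s + 3/2)"
proof -
  define I where "I = (\<lambda>s. LBINT x:{-1<..<1}. gegenbauer_weight s x)"
  define S where "S = {s. Re s > -1}"
  have S: "open S" "connected S"
    unfolding S_def by (simp_all add: open_halfspace_Re_gt convex_connected convex_halfspace_Re_gt)
  have "(\<lambda>s. \<integral>x. indicator {-1<..<1} x *\<^sub>R gegenbauer_weight s x \<partial>lborel) holomorphic_on S"
  proof (rule holomorphic_on_lebesgue_integral[OF S(1)])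
    fix s assume s: "s \<in> S"
    show "(\<lambda>x. indicator {-1<..<1} x *\<^sub>R gegenbauer_weight s x) \<in> borel_measurable lborel"
      by (simp add: borel_measurable_continuous_on_indicator continuous_on_gegenbauer_weight)
    \<comment> \<open>half the distance to the line \<open>Re s = -1\<close>, so that \<open>Re s - e > -1\<close>\<close>
    define e where "e = (Re s + 1) / 2"
    have e: "e > 0" using s by (simp add: e_def S_def)
    have near: "Re u \<ge> Re s - e" if "u \<in> cball s e" for u
      using that abs_Re_le_cmod[of "s - u"] by (simp add: dist_norm)
    show "\<exists>e>0. \<exists>G. cball s e \<subseteq> S \<and> integrable lborel G \<and> (\<forall>u\<in>cball s e. \<forall>x\<in>space lborel.
            norm (indicator {-1<..<1} x *\<^sub>R gegenbauer_weight u x) \<le> G x)"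
    proof (intro exI conjI ballI)
      show "cball s e \<subseteq> S"
        using near e by (force simp: S_def e_def field_simps)
      show "integrable lborel (\<lambda>x. indicator {-1<..<1} x *\<^sub>R (1 - x\<^sup>2) powr (Re s - e))"
        using beta_interval_integral_real(1)[of "Re s - e"] s
        by (simp add: set_integrable_def S_def e_def field_simps)
      fix u :: complex and x :: real
      assume u: "u \<in> cball s e"
      show "norm (indicator {-1<..<1} x *\<^sub>R gegenbauer_weight u x) \<le>
              indicator {-1<..<1} x *\<^sub>R (1 - x\<^sup>2) powr (Re s - e)"
        using near[OF u] one_minus_square_pos[of x]
        by (auto simp: norm_gegenbauer_weight indicator_def intro!: powr_mono')
    qed (fact e)
  next
    fix x :: real
    show "(\<lambda>s. indicator {-1<..<1} x *\<^sub>R gegenbauer_weight s x) holomorphic_on S"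
      unfolding gegenbauer_weight_def scaleR_conv_of_real by (intro holomorphic_intros)
  qed
  then have holo: "I holomorphic_on S"
    by (simp add: I_def set_lebesgue_integral_def)
  have "I s - of_real (sqrt pi) * Gamma (s + 1) * rGamma (s + 3/2) = 0"
  proof (rule analytic_continuation[where S = S and U = "complex_of_real ` {-1<..}" and \<xi> = 0
      and f = "\<lambda>s. I s - of_real (sqrt pi) * Gamma (s + 1) * rGamma (s + 3/2)"])
    show "(\<lambda>s. I s - of_real (sqrt pi) * Gamma (s + 1) * rGamma (s + 3/2)) holomorphic_on S"
    proof (intro holomorphic_intros holo)
      fix z assume "z \<in> S"
      then show "z + 1 \<notin> \<int>\<^sub>\<le>\<^sub>0"
        by (auto elim!: nonpos_Ints_cases simp: complex_eq_iff S_def)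
    qed
    show "(0::complex) islimpt complex_of_real ` {-1<..}"
      unfolding islimpt_approachable
    proof (intro allI impI)
      fix e :: real assume "e > 0"
      then show "\<exists>y\<in>complex_of_real ` {-1<..}. y \<noteq> 0 \<and> dist y 0 < e"
        by (intro bexI[of _ "of_real (e/2)"] imageI) (auto simp: dist_norm norm_divide)
    qed
    fix z assume "z \<in> complex_of_real ` {-1<..}"
    then obtain r where r: "r > -1" "z = of_real r" by auto
    have "I z = (LBINT x:{-1<..<1}. complex_of_real ((1 - x\<^sup>2) powr r))"
      unfolding I_def gegenbauer_weight_def r(2)
    proof (rule set_lebesgue_integral_cong)
      show "\<forall>x. x \<in> {-1<..<1} \<longrightarrow>
        complex_of_real (1 - x\<^sup>2) powr complex_of_real r = complex_of_real ((1 - x\<^sup>2) powr r)"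
        using one_minus_square_pos by (intro allI impI powr_of_real) (auto simp: less_imp_le)
    qed simp
    also have "\<dots> = of_real (sqrt pi * Gamma (r + 1) / Gamma (r + 3/2))"
      using beta_interval_integral_real(2)[OF r(1)] by (simp add: set_integral_complex_of_real)
    also have "\<dots> = of_real (sqrt pi) * Gamma (z + 1) * rGamma (z + 3/2)"
    proof -
      have "Gamma (z + 1) = of_real (Gamma (r + 1))" "Gamma (z + 3/2) = of_real (Gamma (r + 3/2))"
        using Gamma_complex_of_real[of "r + 1"] Gamma_complex_of_real[of "r + 3/2"]
        unfolding r(2) by simp_all
      then show ?thesis
        by (simp only: rGamma_inverse_Gamma divide_inverse of_real_mult of_real_inverse)
    qed
    finally show "I z - of_real (sqrt pi) * Gamma (z + 1) * rGamma (z + 3/2) = 0" by simp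
  qed (use S assms in \<open>auto simp: S_def\<close>)
  then show ?thesis
    by (simp only: I_def rGamma_inverse_Gamma divide_inverse right_minus_eq)
qed

section \<open>An even integral transform as a hypergeometric function\<close>

text \<open>
  The set \<open>(-\<infinity>, -1] \<union> [1, \<infinity>)\<close>: outside it, no \<open>1 - x w\<close> with \<open>x \<in> [-1, 1]\<close> lies on the cut
  of the principal power.
\<close>
definition two_sided_slit :: "complex set" where
  "two_sided_slit = complex_of_real ` {r. \<bar>r\<bar> \<ge> 1}"

text \<open>
  The integral of \<open>(1 - x\<^sup>2)\<^sup>s (1 - x w)\<^bsup>-a\<^esup>\<close> over \<open>(-1, 1)\<close>, as a function of \<open>w\<close>. It is even in \<open>w\<close>
  and, off \<open>two_sided_slit\<close>, holomorphic.
\<close>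
definition gegenbauer_transform :: "complex \<Rightarrow> complex \<Rightarrow> complex \<Rightarrow> complex" where
  "gegenbauer_transform s a w =
     (LBINT x:{-1<..<1}. gegenbauer_weight s x * (1 - of_real x * w) powr (- a))"

lemma open_Compl_two_sided_slit: "open (- two_sided_slit)"
proof -
  have "two_sided_slit = \<real> \<inter> ({w. 1 \<le> Re w} \<union> {w. Re w \<le> -1})"
  proof (intro equalityI subsetI)
    fix w assume "w \<in> \<real> \<inter> ({w. 1 \<le> Re w} \<union> {w. Re w \<le> -1})"
    then have "w = of_real (Re w)" "\<bar>Re w\<bar> \<ge> 1" by auto
    then show "w \<in> two_sided_slit" unfolding two_sided_slit_def by blast
  qed (auto simp: two_sided_slit_def)
  moreover have "closed (\<real> \<inter> ({w. 1 \<le> Re w} \<union> {w. Re w \<le> -1}))"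
    by (intro closed_Int closed_Un closed_complex_Reals closed_halfspace_Re_ge closed_halfspace_Re_le)
  ultimately show ?thesis by (simp only: open_Compl)
qed

lemma one_minus_mult_notin_nonpos_Reals:
  assumes w: "w \<notin> two_sided_slit" and x: "x \<in> {-1..1}"
  shows "1 - of_real x * w \<notin> \<real>\<^sub>\<le>\<^sub>0"
proof
  assume "1 - of_real x * w \<in> \<real>\<^sub>\<le>\<^sub>0"
  then obtain r where r: "r \<le> 0" "1 - of_real x * w = of_real r"
    by (auto elim!: nonpos_Reals_cases)
  then have "of_real x * w = of_real (1 - r)" by (simp add: algebra_simps)
  with r have "x \<noteq> 0" by (auto simp: complex_eq_iff)
  then have "w = of_real ((1 - r) / x)"
    using \<open>of_real x * w = of_real (1 - r)\<close> by (simp add: field_simps)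
  moreover have "\<bar>(1 - r) / x\<bar> \<ge> 1"
  proof -
    have "\<bar>x\<bar> \<le> \<bar>1 - r\<bar>" using r x by auto
    then show ?thesis using \<open>x \<noteq> 0\<close> by (simp add: abs_divide le_divide_eq)
  qed
  ultimately show False using w unfolding two_sided_slit_def by blast
qed

lemma gegenbauer_transform_holomorphic:
  assumes s: "Re s > -1"
  shows "gegenbauer_transform s a holomorphic_on (- two_sided_slit)"
proof -
  let ?k = "\<lambda>w x. (1 - of_real x * w) powr (- a)"
  have base: "Re (1 - of_real x * w) > 0 \<or> Im (1 - of_real x * w) \<noteq> 0" "1 - of_real x * w \<noteq> 0"
    if "w \<in> - two_sided_slit" "x \<in> {-1..1}" for w x
  proof -
    have *: "1 - of_real x * w \<notin> \<real>\<^sub>\<le>\<^sub>0"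
      using one_minus_mult_notin_nonpos_Reals[of w x] that by auto
    then show "Re (1 - of_real x * w) > 0 \<or> Im (1 - of_real x * w) \<noteq> 0"
      unfolding complex_nonpos_Reals_iff by (simp only: de_Morgan_conj not_le)
    show "1 - of_real x * w \<noteq> 0"
    proof
      assume "1 - of_real x * w = 0"
      then have "1 - of_real x * w \<in> \<real>\<^sub>\<le>\<^sub>0" by (simp only: nonpos_Reals_zero_I)
      with * show False by contradiction
    qed
  qed
  have cont: "continuous_on (A \<times> {-1..1}) (\<lambda>(w, x). ?k w x)" if "A \<subseteq> - two_sided_slit" for A
    unfolding case_prod_unfold
  proof (intro continuous_intros)
    show "A \<times> {-1..1} \<subseteq> {p. 0 \<le> Re (1 - complex_of_real (snd p) * fst p) \<or>
            Im (1 - complex_of_real (snd p) * fst p) \<noteq> 0}"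
    proof
      fix p :: "complex \<times> real" assume "p \<in> A \<times> {-1..1}"
      then have "fst p \<in> - two_sided_slit" "snd p \<in> {-1..1}" using that by auto
      from base(1)[OF this] show "p \<in> {p. 0 \<le> Re (1 - complex_of_real (snd p) * fst p) \<or>
            Im (1 - complex_of_real (snd p) * fst p) \<noteq> 0}"
        using less_imp_le by blast
    qed
    show "0 < Re (- a)" if "p \<in> A \<times> {-1..1}" "1 - complex_of_real (snd p) * fst p = 0" for p
      using base(2)[of "fst p" "snd p"] that \<open>A \<subseteq> - two_sided_slit\<close> by auto
  qed
  have contx: "continuous_on {-1..1} (?k w)" if "w \<in> - two_sided_slit" for w
  proof -
    have "continuous_on {-1..1} (\<lambda>x. case (w, x) of (w, x) \<Rightarrow> ?k w x)"
      using that by (intro continuous_on_compose2[OF cont[of "{w}"]] continuous_intros) auto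
    then show ?thesis by simp
  qed
  have "(\<lambda>w. \<integral>x. indicator {-1<..<1} x *\<^sub>R (gegenbauer_weight s x * ?k w x) \<partial>lborel)
          holomorphic_on (- two_sided_slit)"
  proof (rule holomorphic_on_lebesgue_integral[OF open_Compl_two_sided_slit])
    fix w assume w: "w \<in> - two_sided_slit"
    show "(\<lambda>x. indicator {-1<..<1} x *\<^sub>R (gegenbauer_weight s x * ?k w x)) \<in> borel_measurable lborel"
      using set_integrable_gegenbauer_weight[OF s contx[OF w]]
      by (simp add: set_integrable_def borel_measurable_integrable)
    obtain e where e: "e > 0" "cball w e \<subseteq> - two_sided_slit"
      using open_Compl_two_sided_slit w open_contains_cball by blast
    have "bounded ((\<lambda>(w, x). ?k w x) ` (cball w e \<times> {-1..1}))"
      by (intro compact_imp_bounded compact_continuous_image cont e compact_Times) auto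
    then obtain B where B: "\<forall>y\<in>(\<lambda>(w, x). ?k w x) ` (cball w e \<times> {-1..1}). norm y \<le> B"
      unfolding bounded_iff by blast
    have B: "norm (?k u x) \<le> B" if "u \<in> cball w e" "x \<in> {-1..1}" for u x
      using that by (intro bspec[OF B]) (auto intro!: image_eqI[of _ _ "(u, x)"])
    show "\<exists>e>0. \<exists>G. cball w e \<subseteq> - two_sided_slit \<and> integrable lborel G \<and>
        (\<forall>u\<in>cball w e. \<forall>x\<in>space lborel.
          norm (indicator {-1<..<1} x *\<^sub>R (gegenbauer_weight s x * ?k u x)) \<le> G x)"
    proof (intro exI conjI ballI)
      show "integrable lborel (\<lambda>x. B * (indicator {-1<..<1} x *\<^sub>R (1 - x\<^sup>2) powr Re s))"
        using beta_interval_integral_real(1)[OF s] by (simp add: set_integrable_def)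
      fix u :: complex and x :: real
      assume "u \<in> cball w e"
      then show "norm (indicator {-1<..<1} x *\<^sub>R (gegenbauer_weight s x * ?k u x)) \<le>
          B * (indicator {-1<..<1} x *\<^sub>R (1 - x\<^sup>2) powr Re s)"
        using B[of u x]
        by (auto simp: indicator_def norm_mult norm_gegenbauer_weight mult.commute[of B] mult_left_mono)
    qed (fact e)+
  next
    fix x :: real
    show "(\<lambda>w. indicator {-1<..<1} x *\<^sub>R (gegenbauer_weight s x * ?k w x))
            holomorphic_on (- two_sided_slit)"
    proof (cases "x \<in> {-1<..<1}")
      case True
      then have "(\<lambda>w. gegenbauer_weight s x * ?k w x) holomorphic_on (- two_sided_slit)"
        using one_minus_mult_notin_nonpos_Reals[of _ x] by (intro holomorphic_intros) auto
      with True show ?thesis by simp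
    qed simp
  qed
  then show ?thesis
    by (simp add: gegenbauer_transform_def[abs_def] set_lebesgue_integral_def)
qed

lemma gegenbauer_transform_minus: "gegenbauer_transform s a (- w) = gegenbauer_transform s a w"
proof -
  let ?f = "\<lambda>w x. indicator {-1<..<1} x *\<^sub>R (gegenbauer_weight s x * (1 - of_real x * w) powr (- a))"
  have "(\<integral>x. ?f (- w) x \<partial>lborel) = \<bar>-1\<bar> *\<^sub>R (\<integral>x. ?f (- w) (0 + (-1) * x) \<partial>lborel)"
    by (rule lborel_integral_real_affine) simp
  also have "(\<lambda>x. ?f (- w) (0 + (-1) * x)) = ?f w"
    by (rule ext) (auto simp: gegenbauer_weight_def indicator_def)
  finally show ?thesis
    by (simp only: gegenbauer_transform_def set_lebesgue_integral_def abs_minus_cancel abs_one scaleR_one)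
qed

lemma gegenbauer_transform_cong_square:
  assumes "v\<^sup>2 = w\<^sup>2"
  shows "gegenbauer_transform s a v = gegenbauer_transform s a w"
  using assms gegenbauer_transform_minus[of s a w] by (auto simp: power2_eq_iff)

text \<open>
  Expand \<open>(1 - x w)\<^bsup>-a\<^esup>\<close> by the binomial series and integrate termwise. Only the even moments
  survive, and the duplication formulas for \<open>pochhammer\<close> and \<open>fact\<close> turn the resulting series in
  \<open>w\<^sup>2\<close> into a hypergeometric one.
\<close>
lemma gegenbauer_transform_eq_gauss_series:
  assumes s: "Re s > -1" and w: "norm w < 1"
  shows "gegenbauer_transform s a w =
    (LBINT x:{-1<..<1}. gegenbauer_weight s x) *
    gauss_series (a / 2) ((a + 1) / 2) (s + 3/2) (w\<^sup>2)"
proof -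
  define I where "I = (LBINT x:{-1<..<1}. gegenbauer_weight s x)"
  define c where "c = (\<lambda>k. pochhammer a k / fact k)"
  have binom: "(\<lambda>k. c k * u ^ k) sums ((1 - u) powr (- a))" if "norm u < 1" for u
    using binomial_series_one_minus[OF that, of "- a"]
    by (simp add: gbinomial_pochhammer c_def flip: power_mult_distrib)
  \<comment> \<open>any point strictly between \<open>norm w\<close> and \<open>1\<close> gives absolute convergence at \<open>w\<close>\<close>
  have abs: "summable (\<lambda>k. norm (c k * w ^ k))"
  proof (rule powser_insidea)
    show "summable (\<lambda>k. c k * of_real ((1 + norm w) / 2) ^ k)"
      using w by (intro sums_summable[OF binom]) (simp add: norm_divide flip: of_real_add)
    show "norm w < norm (of_real ((1 + norm w) / 2) :: complex)"
      using w by (simp only: norm_of_real) simp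
  qed
  define f where "f = (\<lambda>k x. indicator {-1<..<1} x *\<^sub>R (gegenbauer_weight s x * (c k * w ^ k * of_real x ^ k)))"
  have xk: "norm (c k * w ^ k * of_real x ^ k) \<le> norm (c k * w ^ k)" if "x \<in> {-1<..<1}" for x k
  proof -
    have "\<bar>x\<bar> ^ k \<le> 1" using that by (intro power_le_one) auto
    then show ?thesis by (simp add: norm_mult norm_power mult_left_le)
  qed
  have int: "integrable lborel (f k)" for k
    using set_integrable_gegenbauer_weight[OF s, of "\<lambda>x. c k * w ^ k * of_real x ^ k"]
    by (simp add: f_def set_integrable_def continuous_intros)
  have "(\<lambda>k. integral\<^sup>L lborel (f k)) sums (\<integral>x. (\<Sum>k. f k x) \<partial>lborel)"
  proof (rule sums_integral[OF int])
    show "AE x in lborel. summable (\<lambda>k. norm (f k x))"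
    proof (rule AE_I2)
      fix x :: real
      show "summable (\<lambda>k. norm (f k x))"
      proof (cases "x \<in> {-1<..<1}")
        case True
        have "summable (\<lambda>k. norm (c k * w ^ k * of_real x ^ k))"
          by (rule summable_comparison_test'[OF abs]) (use xk[OF True] in simp)
        then show ?thesis using True by (simp add: f_def norm_mult summable_mult)
      qed (simp add: f_def)
    qed
    show "summable (\<lambda>k. \<integral>x. norm (f k x) \<partial>lborel)"
    proof (rule summable_comparison_test')
      let ?J = "LBINT x:{-1<..<1}. (1 - x\<^sup>2) powr Re s"
      show "summable (\<lambda>k. norm (c k * w ^ k) * ?J)"
        by (rule summable_mult2[OF abs])
      fix k :: nat
      have "(\<integral>x. norm (f k x) \<partial>lborel) \<le>
            (\<integral>x. norm (c k * w ^ k) * (indicator {-1<..<1} x *\<^sub>R (1 - x\<^sup>2) powr Re s) \<partial>lborel)"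
      proof (rule integral_mono)
        show "integrable lborel (\<lambda>x. norm (c k * w ^ k) * (indicator {-1<..<1} x *\<^sub>R (1 - x\<^sup>2) powr Re s))"
          using beta_interval_integral_real(1)[OF s] by (simp add: set_integrable_def)
        show "norm (f k x) \<le> norm (c k * w ^ k) * (indicator {-1<..<1} x *\<^sub>R (1 - x\<^sup>2) powr Re s)" for x
        proof (cases "x \<in> {-1<..<1}")
          case True
          have "norm (f k x) = (1 - x\<^sup>2) powr Re s * norm (c k * w ^ k * of_real x ^ k)"
            using True norm_gegenbauer_weight[OF True, of s] by (simp add: f_def norm_mult)
          also have "\<dots> \<le> (1 - x\<^sup>2) powr Re s * norm (c k * w ^ k)"
            by (intro mult_left_mono xk True) simp
          finally show ?thesis using True by (simp add: mult.commute)
        qed (simp add: f_def)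
      qed (use int in simp)
      then show "norm (\<integral>x. norm (f k x) \<partial>lborel) \<le> norm (c k * w ^ k) * ?J"
        by (simp add: set_lebesgue_integral_def)
    qed
  qed
  also have "(\<integral>x. (\<Sum>k. f k x) \<partial>lborel) = gegenbauer_transform s a w"
    unfolding gegenbauer_transform_def set_lebesgue_integral_def
  proof (rule Bochner_Integration.integral_cong[OF refl])
    fix x :: real
    show "(\<Sum>k. f k x) = indicator {-1<..<1} x *\<^sub>R (gegenbauer_weight s x * (1 - of_real x * w) powr (- a))"
    proof (cases "x \<in> {-1<..<1}")
      case True
      then have "\<bar>x\<bar> * norm w < 1"
        using w mult_le_cancel_right1[of "\<bar>x\<bar>" "norm w"]
        by (intro le_less_trans[OF _ w] mult_left_le_one_le) auto
      then have "(\<lambda>k. c k * (of_real x * w) ^ k) sums ((1 - of_real x * w) powr (- a))"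
        by (intro binom) (simp add: norm_mult)
      from sums_mult[OF this, of "gegenbauer_weight s x"] True show ?thesis
        by (simp add: f_def sums_iff power_mult_distrib mult_ac)
    qed (simp add: f_def)
  qed
  also have "(\<lambda>k. integral\<^sup>L lborel (f k)) =
      (\<lambda>k. c k * w ^ k * (LBINT x:{-1<..<1}. gegenbauer_weight s x * of_real x ^ k))"
    by (simp add: f_def set_lebesgue_integral_def mult_ac flip: Bochner_Integration.integral_mult_right_zero)
  finally have sums: "(\<lambda>k. c k * w ^ k * (LBINT x:{-1<..<1}. gegenbauer_weight s x * of_real x ^ k))
                  sums gegenbauer_transform s a w" .
  have "c k * w ^ k * (LBINT x:{-1<..<1}. gegenbauer_weight s x * of_real x ^ k) = 0"
    if "k \<notin> range ((*) 2)" for k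
  proof -
    from that have "odd k" by (auto elim!: evenE)
    then obtain i where "k = 2 * i + 1" by (elim oddE)
    then show ?thesis using gegenbauer_weight_moment_odd[OF s, of i] by simp
  qed
  moreover have "strict_mono ((*) (2::nat))" by (simp add: strict_mono_def)
  ultimately have "(\<lambda>k. c (2 * k) * w ^ (2 * k) *
            (LBINT x:{-1<..<1}. gegenbauer_weight s x * of_real x ^ (2 * k)))
          sums gegenbauer_transform s a w"
    using sums by (subst sums_mono_reindex)
  also have "(\<lambda>k. c (2 * k) * w ^ (2 * k) *
            (LBINT x:{-1<..<1}. gegenbauer_weight s x * of_real x ^ (2 * k))) =
          (\<lambda>k. I * (pochhammer (a / 2) k * pochhammer ((a + 1) / 2) k /
                 pochhammer (s + 3/2) k * ((w\<^sup>2) ^ k / fact k)))"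
  proof
    fix k
    have "pochhammer (1/2 :: complex) k \<noteq> 0"
      using fact_double[of k, where ?'a = complex] by (metis fact_nonzero mult_zero_left mult_zero_right)
    moreover have "(a + 1) / 2 = a / 2 + 1 / 2" by (simp add: add_divide_distrib)
    ultimately have coeff: "c (2 * k) * pochhammer (1/2) k =
        pochhammer (a / 2) k * pochhammer ((a + 1) / 2) k / fact k"
      using pochhammer_double[of "a / 2" k] unfolding c_def fact_double by (simp only:) simp
    have "c (2 * k) * w ^ (2 * k) * (I * (pochhammer (1/2) k / pochhammer (s + 3/2) k)) =
        I * (w\<^sup>2) ^ k / pochhammer (s + 3/2) k * (c (2 * k) * pochhammer (1/2) k)"
      by (simp add: power_mult)
    then show "c (2 * k) * w ^ (2 * k) *
            (LBINT x:{-1<..<1}. gegenbauer_weight s x * of_real x ^ (2 * k)) =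
          I * (pochhammer (a / 2) k * pochhammer ((a + 1) / 2) k /
                 pochhammer (s + 3/2) k * ((w\<^sup>2) ^ k / fact k))"
      unfolding coeff gegenbauer_weight_moment_even[OF s] I_def by (simp add: mult_ac)
  qed
  finally have even: "(\<lambda>k. I * (pochhammer (a / 2) k * pochhammer ((a + 1) / 2) k /
                 pochhammer (s + 3/2) k * ((w\<^sup>2) ^ k / fact k))) sums gegenbauer_transform s a w" .
  have "I \<noteq> 0"
  proof -
    have "s + 1 \<notin> \<int>\<^sub>\<le>\<^sub>0" "s + 3/2 \<notin> \<int>\<^sub>\<le>\<^sub>0"
      using s by (auto elim!: nonpos_Ints_cases simp: complex_eq_iff)
    then show ?thesis
      by (simp add: I_def gegenbauer_weight_integral[OF s] Gamma_eq_zero_iff)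
  qed
  from sums_unique[OF sums_mult_D[OF even this]]
  have "gauss_series (a / 2) ((a + 1) / 2) (s + 3/2) (w\<^sup>2) = gegenbauer_transform s a w / I"
    unfolding gauss_series_def by (rule sym)
  with \<open>I \<noteq> 0\<close> show ?thesis by (simp add: I_def)
qed

lemma notin_two_sided_slit_of_square:
  assumes "v\<^sup>2 \<notin> gauss_slit"
  shows "v \<notin> two_sided_slit"
proof
  assume "v \<in> two_sided_slit"
  then obtain r where "v = of_real r" "\<bar>r\<bar> \<ge> 1" by (auto simp: two_sided_slit_def)
  then have "v\<^sup>2 = of_real (r\<^sup>2)" "r\<^sup>2 \<in> {1..}"
    using power_mono[of 1 "\<bar>r\<bar>" 2] by auto
  with assms show False unfolding gauss_slit_def by blast
qed

lemma open_Compl_gauss_slit: "open (- gauss_slit)"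
proof -
  have "gauss_slit = \<real> \<inter> {w. 1 \<le> Re w}"
  proof (intro equalityI subsetI)
    fix w assume "w \<in> \<real> \<inter> {w. 1 \<le> Re w}"
    then have "w = of_real (Re w)" "Re w \<ge> 1" by auto
    then show "w \<in> gauss_slit" unfolding gauss_slit_def by blast
  qed (auto simp: gauss_slit_def)
  moreover have "closed (\<real> \<inter> {w. 1 \<le> Re w})"
    by (intro closed_Int closed_complex_Reals closed_halfspace_Re_ge)
  ultimately show ?thesis by (simp only: open_Compl)
qed

text \<open>
  Because the transform is even, its composition with the square root does not see the branch
  cut of \<open>csqrt\<close>: off \<open>[0, \<infinity>)\<close> the root \<open>csqrt u\<close> may be replaced by \<open>\<i> * csqrt (- u)\<close>, which is
  holomorphic across the negative axis. The point \<open>0\<close> is a removable singularity.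
\<close>
lemma gegenbauer_transform_csqrt_holomorphic:
  assumes s: "Re s > -1"
  shows "(\<lambda>u. gegenbauer_transform s a (csqrt u)) holomorphic_on (- gauss_slit)"
proof -
  let ?H = "gegenbauer_transform s a" and ?f = "\<lambda>u. gegenbauer_transform s a (csqrt u)"
  note holo = gegenbauer_transform_holomorphic[OF s, of a]
  have img: "csqrt u \<in> - two_sided_slit" "\<i> * csqrt (- u) \<in> - two_sided_slit"
    if "u \<in> - gauss_slit" for u
    using that notin_two_sided_slit_of_square[of "csqrt u"]
      notin_two_sided_slit_of_square[of "\<i> * csqrt (- u)"]
    by (auto simp: power_mult_distrib)
  let ?A = "- gauss_slit - \<real>\<^sub>\<le>\<^sub>0" and ?B = "- gauss_slit - \<real>\<^sub>\<ge>\<^sub>0"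
  have open_AB: "open ?A" "open ?B"
    by (intro open_Diff open_Compl_gauss_slit closed_nonpos_Reals_complex closed_nonneg_Reals_complex)+
  have "(?H \<circ> csqrt) holomorphic_on ?A"
    using img by (intro holomorphic_on_compose_gen[OF _ holo] holomorphic_on_csqrt') 
      (auto intro!: holomorphic_intros)
  then have A: "?f holomorphic_on ?A" by (simp add: o_def)
  have "(?H \<circ> (\<lambda>u. \<i> * csqrt (- u))) holomorphic_on ?B"
    using img by (intro holomorphic_on_compose_gen[OF _ holo])
      (auto intro!: holomorphic_intros simp: complex_nonpos_Reals_iff complex_nonneg_Reals_iff)
  also have "?this \<longleftrightarrow> ?f holomorphic_on ?B"
    by (intro holomorphic_cong refl)
       (auto intro!: gegenbauer_transform_cong_square simp: power_mult_distrib)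
  finally have B: "?f holomorphic_on ?B" .
  have AB: "- gauss_slit - {0} = ?A \<union> ?B"
    by (auto simp: complex_nonpos_Reals_iff complex_nonneg_Reals_iff complex_eq_iff gauss_slit_def)
  show ?thesis
  proof (rule no_isolated_singularity')
    show "?f holomorphic_on (- gauss_slit - {0})"
      unfolding AB by (rule holomorphic_on_Un[OF A B open_AB])
    fix u :: complex assume "u \<in> {0}"
    then have u: "u = 0" by simp
    have "continuous (at 0) ?H"
      using holomorphic_on_imp_continuous_on[OF holo] open_Compl_two_sided_slit
      by (auto simp: continuous_on_eq_continuous_at two_sided_slit_def)
    moreover have "(csqrt \<longlongrightarrow> 0) (at 0)"
    proof (rule tendsto_norm_zero_cancel)
      have "((\<lambda>u::complex. sqrt (norm u)) \<longlongrightarrow> sqrt (norm (0::complex))) (at 0)"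
        by (intro tendsto_intros)
      then show "((\<lambda>u. norm (csqrt u)) \<longlongrightarrow> 0) (at 0)" by simp
    qed
    ultimately have "(?f \<longlongrightarrow> ?H 0) (at 0)"
      using isCont_tendsto_compose by blast
    then show "(?f \<longlongrightarrow> ?f u) (at u within - gauss_slit)"
      unfolding u by (auto intro: tendsto_within_subset)
  qed (use open_Compl_gauss_slit in auto)
qed

text \<open>
  This identifies the transform with the principal branch of the hypergeometric function also
  where the defining series diverges.
\<close>
lemma gegenbauer_transform_eq_hyp2f1:
  assumes s: "Re s > -1" and w: "w\<^sup>2 \<notin> gauss_slit"
  shows "gegenbauer_transform s a w =
    of_real (sqrt pi) * Gamma (s + 1) / Gamma (s + 3/2) *
    hyp2f1 (a / 2) ((a + 1) / 2) (s + 3/2) (w\<^sup>2)"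
proof -
  define I where "I = (LBINT x:{-1<..<1}. gegenbauer_weight s x)"
  have "s + 1 \<notin> \<int>\<^sub>\<le>\<^sub>0" "s + 3/2 \<notin> \<int>\<^sub>\<le>\<^sub>0"
    using s by (auto elim!: nonpos_Ints_cases simp: complex_eq_iff)
  then have "I \<noteq> 0"
    by (simp add: I_def gegenbauer_weight_integral[OF s] Gamma_eq_zero_iff)
  have "hyp2f1 (a / 2) ((a + 1) / 2) (s + 3/2) (w\<^sup>2) = gegenbauer_transform s a (csqrt (w\<^sup>2)) / I"
  proof (rule hyp2f1_eq_continuation[OF _ _ w])
    show "(\<lambda>u. gegenbauer_transform s a (csqrt u) / I) holomorphic_on - gauss_slit"
      using \<open>I \<noteq> 0\<close> by (intro holomorphic_intros gegenbauer_transform_csqrt_holomorphic s)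
    show "gegenbauer_transform s a (csqrt u) / I = gauss_series (a / 2) ((a + 1) / 2) (s + 3/2) u"
      if "norm u < 1" for u
      using gegenbauer_transform_eq_gauss_series[OF s, of "csqrt u" a] that \<open>I \<noteq> 0\<close>
      by (simp add: I_def)
  qed
  also have "gegenbauer_transform s a (csqrt (w\<^sup>2)) = gegenbauer_transform s a w"
    by (rule gegenbauer_transform_cong_square) simp
  finally show ?thesis
    using \<open>I \<noteq> 0\<close> by (simp add: I_def flip: gegenbauer_weight_integral[OF s])
qed

section \<open>The integral of a power of \<open>z - x\<close>\<close>

lemma diff_notin_nonpos_Reals:
  assumes z: "z \<notin> complex_of_real ` {..1}" and x: "x \<in> {-1..1}"
  shows "z - of_real x \<notin> \<real>\<^sub>\<le>\<^sub>0"
proof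
  assume "z - of_real x \<in> \<real>\<^sub>\<le>\<^sub>0"
  then obtain r where "r \<le> 0" "z - of_real x = of_real r" by (auto elim!: nonpos_Reals_cases)
  then have "z = of_real (r + x)" "r + x \<in> {..1}" using x by (auto simp: algebra_simps)
  with z show False by blast
qed

text \<open>
  The principal powers are multiplicative here because \<open>z\<close> and \<open>z - x\<close> both lie in the upper or both in the
  lower half plane, or both on the positive axis, so that their arguments differ by less than \<open>\<pi>\<close>.
\<close>
lemma powr_diff_of_real:
  assumes z: "z \<notin> complex_of_real ` {..1}" and x: "x \<in> {-1..1}"
  shows "(z - of_real x) powr b = z powr b * (1 - of_real x * (1 / z)) powr b"
proof -
  note nz = diff_notin_nonpos_Reals[OF z, of 0] diff_notin_nonpos_Reals[OF z x]
  then have "z \<noteq> 0" "z - of_real x \<noteq> 0" by auto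
  let ?u = "Ln (z - of_real x) - Ln z"
  have "-pi < Im ?u \<and> Im ?u < pi"
  proof (cases "Im z" "0 :: real" rule: linorder_cases)
    case greater
    then show ?thesis using Im_Ln_pos_lt_imp[of z] Im_Ln_pos_lt_imp[of "z - of_real x"] by auto
  next
    case less
    have "-pi < Im (Ln v) \<and> Im (Ln v) < 0" if "Im v < 0" for v
      using that Im_Ln_pos_le[of v] mpi_less_Im_Ln[of v] Im_Ln_le_pi[of v] by (cases "v = 0") auto
    from this[of z] this[of "z - of_real x"] less show ?thesis by auto
  next
    case equal
    then have "Im (Ln z) = 0" "Im (Ln (z - of_real x)) = 0"
      using nz Im_Ln_eq_0[OF \<open>z \<noteq> 0\<close>] Im_Ln_eq_0[OF \<open>z - of_real x \<noteq> 0\<close>]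
      by (auto simp: complex_nonpos_Reals_iff not_le)
    then show ?thesis by simp
  qed
  moreover have "exp ?u = 1 - of_real x * (1 / z)"
    using \<open>z \<noteq> 0\<close> \<open>z - of_real x \<noteq> 0\<close> by (simp add: exp_diff field_simps)
  ultimately have "Ln (1 - of_real x * (1 / z)) = ?u"
    by (intro Ln_unique) auto
  then have "Ln (z - of_real x) = Ln z + Ln (1 - of_real x * (1 / z))" by simp
  moreover have "1 - of_real x * (1 / z) \<noteq> 0"
    using \<open>z \<noteq> 0\<close> \<open>z - of_real x \<noteq> 0\<close> by (simp add: field_simps)
  ultimately show ?thesis
    using \<open>z \<noteq> 0\<close> \<open>z - of_real x \<noteq> 0\<close>
    unfolding powr_def by (simp only: if_False) (simp add: distrib_left exp_add)
qed

lemma gegenbauer_weight_cauchy_integral: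
  assumes s: "Re s > -1" and z: "z \<notin> complex_of_real ` {..1}"
  shows "(LBINT x:{-1<..<1}. gegenbauer_weight s x * (z - of_real x) powr (- a)) =
    of_real (sqrt pi) * Gamma (s + 1) / Gamma (s + 3/2) * z powr (- a) *
    hyp2f1 (a / 2) ((a + 1) / 2) (s + 3/2) (1 / z\<^sup>2)"
proof -
  have "z \<noteq> 0" using diff_notin_nonpos_Reals[OF z, of 0] by auto
  have "(1 / z)\<^sup>2 \<notin> gauss_slit"
  proof
    assume "(1 / z)\<^sup>2 \<in> gauss_slit"
    then obtain r where r: "r \<ge> 1" "(1 / z)\<^sup>2 = of_real r" by (auto simp: gauss_slit_def)
    then have "z\<^sup>2 = of_real (1 / r)" using \<open>z \<noteq> 0\<close> by (auto simp: field_simps)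
    also have "\<dots> = (of_real (sqrt (1 / r)))\<^sup>2"
      using r by (simp only: flip: of_real_power) simp
    finally have "z = of_real (sqrt (1 / r)) \<or> z = of_real (- sqrt (1 / r))"
      by (simp only: power2_eq_iff of_real_minus)
    moreover have "sqrt (1 / r) \<le> 1" "- sqrt (1 / r) \<le> 1" using r
      by (auto intro: order_trans[of _ 0])
    ultimately show False using z by blast
  qed
  from gegenbauer_transform_eq_hyp2f1[OF s this, of a]
  have "z powr (- a) * gegenbauer_transform s a (1 / z) =
      of_real (sqrt pi) * Gamma (s + 1) / Gamma (s + 3/2) * z powr (- a) *
      hyp2f1 (a / 2) ((a + 1) / 2) (s + 3/2) (1 / z\<^sup>2)"
    by (simp add: power_divide mult_ac)
  moreover have "z powr (- a) * gegenbauer_transform s a (1 / z) =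
      (LBINT x:{-1<..<1}. z powr (- a) *
         (gegenbauer_weight s x * (1 - of_real x * (1 / z)) powr (- a)))"
    unfolding gegenbauer_transform_def by (rule set_integral_mult_right[symmetric])
  moreover have "\<dots> = (LBINT x:{-1<..<1}. gegenbauer_weight s x * (z - of_real x) powr (- a))"
    by (rule set_lebesgue_integral_cong) (auto simp: powr_diff_of_real[OF z] mult_ac)
  ultimately show ?thesis by simp
qed

section \<open>Repeated integration by parts\<close>

text \<open>
  In the variable \<open>t = (1 - x) / 2\<close> one has \<open>1 - 2 t = x\<close> and \<open>t (1 - t) = (1 - x\<^sup>2) / 4\<close>; the recursion
  of \<open>rodrigues_poly\<close> therefore matches the derivative of
  \<open>(1 - x\<^sup>2)\<^bsup>a-j\<^esup> q(t) (z - x)\<^bsup>-b\<^esup>\<close> for \<open>q = rodrigues_poly a j\<close>.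
\<close>
lemma rodrigues_integral_by_parts_step:
  assumes s: "Re (a - of_nat (Suc j)) > -1" and z: "z \<notin> complex_of_real ` {..1}"
  shows "(LBINT x:{-1<..<1}. gegenbauer_weight (a - of_nat (Suc j)) x *
            (poly (rodrigues_poly a (Suc j)) (of_real ((1 - x) / 2)) * (z - of_real x) powr (- b))) =
         b / 2 * (LBINT x:{-1<..<1}. gegenbauer_weight (a - of_nat j) x *
            (poly (rodrigues_poly a j) (of_real ((1 - x) / 2)) * (z - of_real x) powr (- (b + 1))))"
proof -
  define s where "s = a - of_nat (Suc j)"
  define t where "t = (\<lambda>x. complex_of_real ((1 - x) / 2))"
  define P where "P = (\<lambda>j x. poly (rodrigues_poly a j) (t x))"
  define P' where "P' = (\<lambda>x. poly (pderiv (rodrigues_poly a j)) (t x))"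
  define g where "g = (\<lambda>c x. (z - complex_of_real x) powr (- c))"
  have s1: "s + 1 = a - of_nat j" by (simp add: s_def)
  have Re: "Re s > -1" "Re (a - of_nat j) > -1" using s by (simp_all add: s_def)
  have cont_t: "continuous_on A t" for A unfolding t_def by (intro continuous_intros) auto
  have contP: "continuous_on A (P i)" "continuous_on A P'" for i A
    unfolding P_def P'_def by (intro continuous_on_poly cont_t)+
  have contg: "continuous_on {-1..1} (g c)" for c
    unfolding g_def using diff_notin_nonpos_Reals[OF z]
    by (intro continuous_intros) (fastforce simp: complex_nonpos_Reals_iff not_le)+
  let ?G' = "\<lambda>x. b * P j x * g (b + 1) x - P' x / 2 * g b x"
  have deriv: "((\<lambda>x. P j x * g b x) has_vector_derivative ?G' x) (at x)"
    if x: "x \<in> {-1<..<1}" for x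
  proof -
    have exponent: "- b - 1 = - 1 - b" by simp
    have "((\<lambda>u. poly (rodrigues_poly a j) ((1 - u) / 2) * (z - u) powr (- b)) has_field_derivative
        ?G' x) (at (of_real x))"
      using diff_notin_nonpos_Reals[OF z, of x] x
      by (auto intro!: derivative_eq_intros DERIV_chain'[OF _ poly_DERIV]
               simp: P_def P'_def g_def t_def exponent algebra_simps)
    from has_vector_derivative_real_field[OF this] show ?thesis
      by (simp add: P_def g_def t_def)
  qed
  have "0 = (LBINT x:{-1<..<1}. gegenbauer_weight s x *
            (of_real (1 - x\<^sup>2) * ?G' x - 2 * (s + 1) * of_real x * (P j x * g b x)))"
    by (rule gegenbauer_weight_integral_by_parts[OF Re(1) _ _ deriv, symmetric])
       (auto intro!: continuous_intros contP contg)
  also have "\<dots> = (LBINT x:{-1<..<1}. b * (gegenbauer_weight (a - of_nat j) x * (P j x * g (b + 1) x)) -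
            2 * (gegenbauer_weight s x * (P (Suc j) x * g b x)))"
  proof (rule set_lebesgue_integral_cong)
    have "gegenbauer_weight s x *
            (of_real (1 - x\<^sup>2) * ?G' x - 2 * (s + 1) * of_real x * (P j x * g b x)) =
          b * (gegenbauer_weight (a - of_nat j) x * (P j x * g (b + 1) x)) -
            2 * (gegenbauer_weight s x * (P (Suc j) x * g b x))" if x: "x \<in> {-1<..<1}" for x
    proof -
      have "P (Suc j) x = (s + 1) * of_real x * P j x + of_real (1 - x\<^sup>2) / 4 * P' x"
        unfolding s1 by (simp add: P_def P'_def t_def power2_eq_square field_simps)
      moreover have "gegenbauer_weight (a - of_nat j) x = of_real (1 - x\<^sup>2) * gegenbauer_weight s x"
        using gegenbauer_weight_Suc[OF x, of s] by (simp only: s1)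
      ultimately show ?thesis by (simp only:) (simp add: field_simps)
    qed
    then show "\<forall>x. x \<in> {-1<..<1} \<longrightarrow> gegenbauer_weight s x *
            (of_real (1 - x\<^sup>2) * ?G' x - 2 * (s + 1) * of_real x * (P j x * g b x)) =
          b * (gegenbauer_weight (a - of_nat j) x * (P j x * g (b + 1) x)) -
            2 * (gegenbauer_weight s x * (P (Suc j) x * g b x))" by blast
  qed simp
  also have "\<dots> = b * (LBINT x:{-1<..<1}. gegenbauer_weight (a - of_nat j) x * (P j x * g (b + 1) x)) -
            2 * (LBINT x:{-1<..<1}. gegenbauer_weight s x * (P (Suc j) x * g b x))"
    by (subst set_integral_diff)
       (auto intro!: set_integrable_mult_right set_integrable_gegenbauer_weight Re continuous_intros contP contg)
  finally show ?thesis by (simp add: P_def g_def t_def s_def field_simps)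
qed

lemma rodrigues_integral_by_parts:
  assumes "Re (a - of_nat j) > -1" and z: "z \<notin> complex_of_real ` {..1}"
  shows "(LBINT x:{-1<..<1}. gegenbauer_weight (a - of_nat j) x *
            (poly (rodrigues_poly a j) (of_real ((1 - x) / 2)) * (z - of_real x) powr (- b))) =
         pochhammer b j / 2 ^ j *
         (LBINT x:{-1<..<1}. gegenbauer_weight a x * (z - of_real x) powr (- (b + of_nat j)))"
  using assms(1)
proof (induction j arbitrary: b)
  case (Suc j)
  then have "Re (a - of_nat j) > -1" by simp
  from Suc.IH[OF this, of "b + 1"] show ?case
    unfolding rodrigues_integral_by_parts_step[OF Suc.prems z]
    by (simp only:) (simp add: pochhammer_rec add_ac)
qed simp

section \<open>The integral of the Ferrers function\<close>

text \<open>
  The Rodrigues formula for the Ferrers function: the factor \<open>(1 - t)\<^sup>\<mu>\<close>, with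
  \<open>1 - t = (1 + x) / 2\<close>, that \<open>eval_rodrigues_fps\<close> splits off completes the algebraic factors to
  \<open>(1 - x\<^sup>2)\<^sup>\<mu>\<close>.
\<close>
lemma ferrers_weight_eq:
  fixes n :: nat and \<mu> :: complex
  assumes \<mu>: "Re \<mu> > -1" and x: "x \<in> {-1<..<1}"
  shows "ferrers_P_neg (of_nat n + \<mu>) \<mu> x * of_real (1 - x\<^sup>2) powr (\<mu> / 2) =
    2 powr (- \<mu>) / Gamma (of_nat n + \<mu> + 1) *
    (gegenbauer_weight \<mu> x * poly (rodrigues_poly (of_nat n + \<mu>) n) (of_real ((1 - x) / 2)))"
proof -
  define t where "t = complex_of_real ((1 - x) / 2)"
  define l where "l = of_nat n + \<mu>"
  define q where "q = poly (rodrigues_poly l n) t"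
  have t: "norm t < 1" using x unfolding t_def norm_of_real by (auto simp: abs_if)
  have nonpole: "\<mu> + 1 \<notin> \<int>\<^sub>\<le>\<^sub>0" "l + 1 \<notin> \<int>\<^sub>\<le>\<^sub>0"
    using \<mu> by (auto elim!: nonpos_Ints_cases simp: complex_eq_iff l_def)
  have poch: "pochhammer (\<mu> + 1) n = Gamma (l + 1) / Gamma (\<mu> + 1)"
    using pochhammer_Gamma[OF nonpole(1), of n] by (simp add: l_def add_ac)
  have nz: "Gamma (\<mu> + 1) \<noteq> 0" "Gamma (l + 1) \<noteq> 0"
    using nonpole by (simp_all add: Gamma_eq_zero_iff)
  have "l - of_nat n = \<mu>" by (simp add: l_def)
  then have "pochhammer (\<mu> + 1) n * hyp2f1 (- l) (l + 1) (\<mu> + 1) t = (1 - t) powr \<mu> * q"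
    using eval_rodrigues_fps_eq_gauss_series[OF \<mu> t, of n] eval_rodrigues_fps[OF t, of l n] t
    by (simp add: hyp2f1_def l_def[symmetric] q_def)
  then have hyp: "1 / Gamma (\<mu> + 1) * hyp2f1 (- l) (l + 1) (\<mu> + 1) t =
      (1 - t) powr \<mu> * q / Gamma (l + 1)"
    unfolding poch using nz by (simp add: field_simps)
  have powers: "of_real ((1 - x) / (1 + x)) powr (\<mu> / 2) * of_real (1 - x\<^sup>2) powr (\<mu> / 2) *
      (1 - t) powr \<mu> = 2 powr (- \<mu>) * gegenbauer_weight \<mu> x"
  proof -
    have pow: "of_real r powr c = exp (c * of_real (ln r))" if "r > 0" for r :: real and c :: complex
      using that by (simp add: powr_def Ln_of_real)
    define A B where "A = complex_of_real (ln (1 - x))" and "B = complex_of_real (ln (1 + x))"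
    have pos: "1 - x > 0" "1 + x > 0" using x by auto
    have e1: "of_real ((1 - x) / (1 + x)) powr (\<mu> / 2) = exp (\<mu> / 2 * (A - B))"
      using pos by (subst pow) (simp_all add: A_def B_def ln_div)
    have e2: "of_real (1 - x\<^sup>2) powr c = exp (c * (A + B))" for c
    proof -
      have "1 - x\<^sup>2 = (1 - x) * (1 + x)" by (simp add: power2_eq_square algebra_simps)
      then have "ln (1 - x\<^sup>2) = ln (1 - x) + ln (1 + x)" using pos by (simp only: ln_mult_pos)
      then show ?thesis
        using one_minus_square_pos[OF x] by (subst pow) (simp_all add: A_def B_def)
    qed
    have "1 - t = of_real ((1 + x) / 2)" by (simp add: t_def field_simps)
    then have "(1 - t) powr \<mu> = of_real ((1 + x) / 2) powr \<mu>" by (rule arg_cong)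
    also have "\<dots> = exp (\<mu> * (B - of_real (ln 2)))"
      using pos by (subst pow) (simp_all add: B_def ln_div)
    finally have e3: "(1 - t) powr \<mu> = exp (\<mu> * (B - of_real (ln 2)))" .
    have e4: "2 powr (- \<mu>) = exp (- \<mu> * of_real (ln 2))"
      using pow[of 2 "- \<mu>"] by simp
    have "\<mu> / 2 * (A - B) + \<mu> / 2 * (A + B) + \<mu> * (B - of_real (ln 2)) =
        - \<mu> * of_real (ln 2) + \<mu> * (A + B)"
      by (simp add: field_simps)
    then show ?thesis
      unfolding gegenbauer_weight_def e1 e2 e3 e4 exp_add[symmetric] by (rule arg_cong)
  qed
  have "ferrers_P_neg l \<mu> x * of_real (1 - x\<^sup>2) powr (\<mu> / 2) =
      (1 / Gamma (\<mu> + 1) * hyp2f1 (- l) (l + 1) (\<mu> + 1) t) *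
      (of_real ((1 - x) / (1 + x)) powr (\<mu> / 2) * of_real (1 - x\<^sup>2) powr (\<mu> / 2))"
    by (simp only: ferrers_P_neg_def t_def mult_ac)
  also have "\<dots> = q / Gamma (l + 1) * (of_real ((1 - x) / (1 + x)) powr (\<mu> / 2) *
      of_real (1 - x\<^sup>2) powr (\<mu> / 2) * (1 - t) powr \<mu>)"
    unfolding hyp by (simp only: mult_ac times_divide_eq_right times_divide_eq_left)
  also have "\<dots> = 2 powr (- \<mu>) / Gamma (l + 1) * (gegenbauer_weight \<mu> x * q)"
    unfolding powers by (simp only: mult_ac times_divide_eq_right times_divide_eq_left)
  finally show ?thesis by (simp only: l_def q_def t_def)
qed

theorem corollary3p5:
  fixes n l :: nat and \<nu> \<mu> z :: complex
  assumes "n \<ge> l"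
    and "Re \<mu> > -1"
    and "z \<notin> complex_of_real ` {..1}"
  shows "set_integrable lborel {-1<..<1}
           (\<lambda>x. ferrers_P_neg (of_nat n + \<mu>) \<mu> x / (z - of_real x) powr \<nu> *
                of_real (1 - x\<^sup>2) powr (\<mu> / 2)) \<and>
         (LBINT x:{-1<..<1}. ferrers_P_neg (of_nat n + \<mu>) \<mu> x / (z - of_real x) powr \<nu> *
                of_real (1 - x\<^sup>2) powr (\<mu> / 2)) =
         2 * pochhammer \<nu> n * olver_Q (of_nat n + \<mu>) (\<nu> - \<mu> - 1) z /
           sqm1_powr z ((\<nu> - \<mu> - 1) / 2)"
proof -
  note \<mu> = assms(2) and z = assms(3)
  define a where "a = of_nat n + \<mu>"
  define C where "C = 2 powr (- \<mu>) / Gamma (a + 1)"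
  define h where "h = (\<lambda>x. poly (rodrigues_poly a n) (of_real ((1 - x) / 2)) *
      (z - complex_of_real x) powr (- \<nu>))"
  define F where "F = hyp2f1 ((\<nu> + of_nat n) / 2) ((\<nu> + of_nat n + 1) / 2) (a + 3/2) (1 / z\<^sup>2)"
  let ?f = "\<lambda>x. ferrers_P_neg (of_nat n + \<mu>) \<mu> x / (z - of_real x) powr \<nu> *
                of_real (1 - x\<^sup>2) powr (\<mu> / 2)"
  have an: "a - of_nat n = \<mu>" and Re_a: "Re a > -1" using \<mu> by (simp_all add: a_def)
  have f_eq: "?f x = C * (gegenbauer_weight \<mu> x * h x)" if "x \<in> {-1<..<1}" for x
  proof -
    have "?f x = ferrers_P_neg (of_nat n + \<mu>) \<mu> x * of_real (1 - x\<^sup>2) powr (\<mu> / 2) *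
        (z - of_real x) powr (- \<nu>)"
      unfolding powr_minus divide_inverse by (simp only: mult_ac)
    then show ?thesis
      unfolding ferrers_weight_eq[OF \<mu> that] by (simp only: C_def h_def a_def mult_ac)
  qed
  have "continuous_on {-1..1} h"
    unfolding h_def
  proof (intro continuous_intros continuous_on_poly)
    show "{-1..1} \<subseteq> {x. 0 \<le> Re (z - of_real x) \<or> Im (z - of_real x) \<noteq> 0}"
      using diff_notin_nonpos_Reals[OF z] by (force simp: complex_nonpos_Reals_iff)
    show "0 < Re (- \<nu>)" if "x \<in> {-1..1}" "z - of_real x = 0" for x
      using diff_notin_nonpos_Reals[OF z that(1)] that(2) by simp
  qed auto
  then have int: "set_integrable lborel {-1<..<1} (\<lambda>x. C * (gegenbauer_weight \<mu> x * h x))"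
    by (intro set_integrable_mult_right set_integrable_gegenbauer_weight \<mu>)
  have "(LBINT x:{-1<..<1}. ?f x) = (LBINT x:{-1<..<1}. C * (gegenbauer_weight \<mu> x * h x))"
    using f_eq by (intro set_lebesgue_integral_cong allI impI) simp_all
  also have "\<dots> = C * (LBINT x:{-1<..<1}. gegenbauer_weight \<mu> x * h x)"
    by (rule set_integral_mult_right)
  also have "(LBINT x:{-1<..<1}. gegenbauer_weight \<mu> x * h x) = pochhammer \<nu> n / 2 ^ n *
      (LBINT x:{-1<..<1}. gegenbauer_weight a x * (z - of_real x) powr (- (\<nu> + of_nat n)))"
    using rodrigues_integral_by_parts[of a n z \<nu>, unfolded an, OF \<mu> z] by (simp only: h_def)
  also have "\<dots> = pochhammer \<nu> n / 2 ^ n * (of_real (sqrt pi) * Gamma (a + 1) / Gamma (a + 3/2) *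
      z powr (- (\<nu> + of_nat n)) * F)"
    unfolding F_def gegenbauer_weight_cauchy_integral[OF Re_a z] ..
  also have "C * (pochhammer \<nu> n / 2 ^ n * (of_real (sqrt pi) * Gamma (a + 1) / Gamma (a + 3/2) *
      z powr (- (\<nu> + of_nat n)) * F)) = 2 * pochhammer \<nu> n * (of_real (sqrt pi) /
      (2 powr (a + 1) * Gamma (a + 3/2) * z powr (\<nu> + of_nat n)) * F)"
  proof -
    have "a + 1 \<notin> \<int>\<^sub>\<le>\<^sub>0"
      using Re_a by (auto elim!: nonpos_Ints_cases simp: complex_eq_iff)
    then have "Gamma (a + 1) \<noteq> 0" by (simp add: Gamma_eq_zero_iff)
    define M Z G where "M = 2 powr \<mu>" and "Z = z powr (\<nu> + of_nat n)" and "G = Gamma (a + 1)"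
    have "2 powr (a + 1) = 2 * 2 ^ n * M"
      by (simp add: a_def M_def powr_add powr_nat')
    moreover have "2 powr (- \<mu>) = inverse M" "z powr (- (\<nu> + of_nat n)) = inverse Z"
      unfolding M_def Z_def by (rule powr_minus)+
    ultimately show ?thesis
      using \<open>Gamma (a + 1) \<noteq> 0\<close> unfolding C_def G_def[symmetric] Z_def[symmetric]
      by (simp only:) (simp add: inverse_eq_divide mult_ac)
  qed
  also have "\<dots> = 2 * pochhammer \<nu> n * olver_Q (of_nat n + \<mu>) (\<nu> - \<mu> - 1) z /
           sqm1_powr z ((\<nu> - \<mu> - 1) / 2)"
  proof -
    \<comment> \<open>as \<open>z\<close> is neither \<open>1\<close> nor \<open>-1\<close>, the power of \<open>z\<^sup>2 - 1\<close> in \<open>olver_Q\<close> cancels\<close>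
    have "complex_of_real 1 \<in> complex_of_real ` {..1}" "complex_of_real (-1) \<in> complex_of_real ` {..1}"
      by (intro imageI; simp)+
    with z have "z \<noteq> 1" "z \<noteq> -1" by auto
    then have "sqm1_powr z ((\<nu> - \<mu> - 1) / 2) \<noteq> 0"
      by (simp add: sqm1_powr_def flip: eq_neg_iff_add_eq_0)
    moreover have "of_nat n + \<mu> + (\<nu> - \<mu> - 1) + 1 = \<nu> + of_nat n"
      "of_nat n + \<mu> + (\<nu> - \<mu> - 1) + 2 = \<nu> + of_nat n + 1" by simp_all
    ultimately show ?thesis
      unfolding olver_Q_def F_def by (simp add: a_def add_ac mult_ac)
  qed
  finally have "(LBINT x:{-1<..<1}. ?f x) = 2 * pochhammer \<nu> n * olver_Q (of_nat n + \<mu>) (\<nu> - \<mu> - 1) z /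
           sqm1_powr z ((\<nu> - \<mu> - 1) / 2)" .
  moreover have "set_integrable lborel {-1<..<1} ?f"
    using int by (subst set_integrable_cong[OF refl refl f_eq]) auto
  ultimately show ?thesis by blast
qed

end
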